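(* The growth rate of the class of permutations avoiding $1324$ satisfies $\mathrm{gr}(\mathrm{Av}(1324)) > 9.81$.
   Context: A permutation $\sigma=\sigma_1\cdots\sigma_n$ of $\{1,\dots,n\}$ avoids a permutation $\pi$ of $\{1,\dots,k\}$ if no subsequence of $\sigma$ has the same relative order as $\pi$. $\mathrm{Av}(1324)$ is the set of permutations avoiding $1324$, and $S_n(1324)$ is the number of such permutations of length $n$. The growth rate is $\mathrm{gr}(\mathrm{Av}(1324))=\lim_{n\to\infty} S_n(1324)^{1/n}$; this limit exists and is finite. *)

theory Defs
  imports "HOL-Analysis.Analysis"
begin

definition perms_of_length :: "nat \<Rightarrow> nat list set" where
  "perms_of_length n = {s. length s = n \<and> distinct s \<and> set s = {1..n}}"

definition contains_pattern :: "nat list \<Rightarrow> nat list \<Rightarrow> bool" where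
  "contains_pattern s p \<longleftrightarrow>
     (\<exists>f. strict_mono_on {..<length p} f \<and> (\<forall>i<length p. f i < length s) \<and>
          (\<forall>i<length p. \<forall>j<length p. (s ! f i < s ! f j \<longleftrightarrow> p ! i < p ! j)))"

definition avoids :: "nat list \<Rightarrow> nat list \<Rightarrow> bool" where
  "avoids s p \<longleftrightarrow> \<not> contains_pattern s p"

definition num_avoiders :: "nat list \<Rightarrow> nat \<Rightarrow> nat" where
  "num_avoiders p n = card {s \<in> perms_of_length n. avoids s p}"

definition growth_rate :: "nat list \<Rightarrow> real" where
  "growth_rate p = lim (\<lambda>n. root n (real (num_avoiders p n)))"

end

(* Staircases of dominoes. A domino is a 213-avoider stacked on a 132-avoider such that no 1324 arises.
   Dominoes are joined into a descending staircase by decreasing runs of points, which interleave freely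
   with both neighbouring cells; a 1324 in a staircase lies in two adjacent cells, so none arises.
   If g is the growth rate and there are d dominoes with cells of p and q points, counting long
   staircases gives d binom(p+k,k) binom(q+l,l) <= g^(p+q+(k+l)/2) for all run lengths k and l.
   Summing over k and l shows that dominoes grow at most like g (1 - 1/sqrt g), which is less than 6.69
   if g <= 9.81. On the other hand the generating function of the dominoes satisfies a quadratic
   equation with one catalytic variable, and the quadratic method parametrizes it by
   z = t/(1+t)^3, f = (1+t)^3 (1-t), so that dominoes grow like 27/4.
   That the limit exists follows from supermultiplicativity (skew sums) and an upper bound 16^n:
   a 1324-avoider is a union of a red 132-avoider and a blue 213-avoider. *)

theory Submission
  imports Defs "HOL-Complex_Analysis.Complex_Analysis" "HOL-Combinatorics.Permutations"
begin

section \<open>Permutations and gluing\<close>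

text \<open>The exponent (k+l)/2 comes from sharing: every run belongs to two consecutive dominoes,
  so a domino pays for only half of its run points but keeps both binomial factors. Repeating one
  block together with its inverse fixes p and q throughout, so that no typical cell sizes have to be
  found. Summation over the run lengths replaces the choice of optimal ones: the series of
  binom(p+k,k) w^k is (1-w)^-(p+1), and for w below 1/sqrt g it can be compared with a convergent
  geometric series. The two cells together then contribute (1-w)^(p+q), whatever the split. The
  critical value solves g - sqrt g = 27/4, that is g = (29 + 4 sqrt 7)/4 = 9.895...; the distance to
  9.81 leaves room for rational constants. Only a lower bound for the dominoes is required, so the
  trees merely have to inject into them. No asymptotics are extracted either: a growth rate of at
  most 9.81 would make the tree series converge beyond 4/27, which contradicts the parametrization
  by analytic continuation.\<close>

definition av1324 :: "nat \<Rightarrow> (nat \<Rightarrow> nat) \<Rightarrow> bool" where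
  "av1324 n f \<longleftrightarrow> (\<forall>i j k l. i < j \<longrightarrow> j < k \<longrightarrow> k < l \<longrightarrow> l < n \<longrightarrow>
     \<not> (f i < f k \<and> f k < f j \<and> f j < f l))"

text \<open>Positions and values are both counted from 0 and everything from \<open>n\<close> on is
  fixed; they are then on an equal footing, and \<open>inv\<close> exchanges them.\<close>

definition Av :: "nat \<Rightarrow> (nat \<Rightarrow> nat) set" where
  "Av n = {f. f permutes {..<n} \<and> av1324 n f}"

lemma av1324D:
  "av1324 n f \<Longrightarrow> i < j \<Longrightarrow> j < k \<Longrightarrow> k < l \<Longrightarrow> l < n \<Longrightarrow>
    f i < f k \<Longrightarrow> f k < f j \<Longrightarrow> f j < f l \<Longrightarrow> False"
  unfolding av1324_def by blast

lemma finite_Av: "finite (Av n)"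
  unfolding Av_def using finite_permutations[of "{..<n}"] by (rule rev_finite_subset) auto

lemma permutes_less:
  fixes f :: "nat \<Rightarrow> nat"
  assumes "f permutes {..<n}"
  shows "f i < n \<longleftrightarrow> i < n"
  using permutes_in_image[OF assms, of i] by simp

lemma permutes_rank:
  fixes f :: "nat \<Rightarrow> nat"
  assumes f: "f permutes {..<n}" and i: "i < n"
  shows "f i = card {j. j < n \<and> f j < f i}"
proof -
  have "f ` {j. j < n \<and> f j < f i} = {..<f i}"
  proof (rule set_eqI, rule iffI)
    fix y assume "y \<in> {..<f i}"
    then have "y < n" using permutes_less[OF f, of i] i by auto
    then have "y = f (inv f y)" "inv f y < n"
      using permutes_inverses(1)[OF f] permutes_less[OF permutes_inv[OF f]] by auto
    with \<open>y \<in> {..<f i}\<close> show "y \<in> f ` {j. j < n \<and> f j < f i}" by auto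
  qed auto
  then have "card {..<f i} = card {j. j < n \<and> f j < f i}"
    using card_image[OF inj_on_subset[OF permutes_inj[OF f], of "{j. j < n \<and> f j < f i}"]]
    by simp
  then show ?thesis by simp
qed

text \<open>The constructions below preserve their ingredients up to relative order; this turns such
  a copy back into an equality, since a value is the rank of its entry.\<close>

lemma permutes_eqI:
  fixes f g :: "nat \<Rightarrow> nat"
  assumes f: "f permutes {..<n}" and g: "g permutes {..<n}"
    and ord: "\<And>i j. i < n \<Longrightarrow> j < n \<Longrightarrow> f i < f j \<longleftrightarrow> g i < g j"
  shows "f = g"
proof
  fix i
  show "f i = g i"
  proof (cases "i < n")
    case True
    then have "{j. j < n \<and> f j < f i} = {j. j < n \<and> g j < g i}" using ord by auto
    then show ?thesis using permutes_rank[OF f True] permutes_rank[OF g True] by simp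
  next
    case False
    then show ?thesis using permutes_not_in[OF f] permutes_not_in[OF g] by simp
  qed
qed

lemma permutesI_less:
  fixes f :: "nat \<Rightarrow> nat"
  assumes "\<And>i. i < n \<Longrightarrow> f i < n" and "\<And>i. i \<ge> n \<Longrightarrow> f i = i" and "inj_on f {..<n}"
  shows "f permutes {..<n}"
proof (rule bij_imp_permutes)
  have "f ` {..<n} = {..<n}"
    by (rule endo_inj_surj) (use assms in auto)
  then show "bij_betw f {..<n} {..<n}" using assms(3) by (simp add: bij_betw_def)
qed (use assms in auto)

section \<open>Translation of avoiding lists into functions\<close>

lemma contains_1324_iff:
  "contains_pattern s [1, 3, 2, 4] \<longleftrightarrow>
    (\<exists>i j k l. i < j \<and> j < k \<and> k < l \<and> l < length s \<and> s ! i < s ! k \<and> s ! k < s ! j \<and> s ! j < s ! l)"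
    (is "?L \<longleftrightarrow> ?R")
proof
  assume ?L
  then obtain f where f: "strict_mono_on {..<4} f" "\<forall>i<4. f i < length s"
    and o: "\<forall>i<4. \<forall>j<4. (s ! f i < s ! f j \<longleftrightarrow> [1, 3, 2, 4::nat] ! i < [1, 3, 2, 4] ! j)"
    unfolding contains_pattern_def by (auto simp: numeral_eq_Suc)
  have "f 0 < f 1" "f 1 < f 2" "f 2 < f 3" "f 3 < length s"
    using f by (auto simp: strict_mono_on_def)
  moreover have "s ! f 0 < s ! f 2" "s ! f 2 < s ! f 1" "s ! f 1 < s ! f 3"
    using o[rule_format, of 0 2] o[rule_format, of 2 1] o[rule_format, of 1 3] by simp_all
  ultimately show ?R by blast
next
  assume ?R
  then obtain i j k l where *: "i < j" "j < k" "k < l" "l < length s"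
    "s ! i < s ! k" "s ! k < s ! j" "s ! j < s ! l" by blast
  define f where "f = (\<lambda>x. [i, j, k, l] ! x)"
  have "strict_mono_on {..<length [1, 3, 2, 4::nat]} f"
    using * by (auto simp: strict_mono_on_def f_def less_Suc_eq numeral_eq_Suc)
  moreover have "\<forall>i<length [1, 3, 2, 4::nat]. f i < length s"
    using * by (auto simp: f_def less_Suc_eq numeral_eq_Suc)
  moreover have "\<forall>i<length [1, 3, 2, 4::nat]. \<forall>j<length [1, 3, 2, 4::nat].
      (s ! f i < s ! f j \<longleftrightarrow> [1, 3, 2, 4::nat] ! i < [1, 3, 2, 4] ! j)"
    using * by (auto simp: f_def less_Suc_eq numeral_eq_Suc)
  ultimately show ?L unfolding contains_pattern_def by blast
qed

lemma num_avoiders_eq: "num_avoiders [1, 3, 2, 4] n = card (Av n)"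
proof -
  define h where "h = (\<lambda>f::nat \<Rightarrow> nat. map (\<lambda>i. f i + 1) [0..<n])"
  have "bij_betw h (Av n) {s \<in> perms_of_length n. avoids s [1, 3, 2, 4]}"
    unfolding bij_betw_def
  proof
    show "inj_on h (Av n)"
    proof (rule inj_onI)
      fix f g assume "f \<in> Av n" "g \<in> Av n" and hh: "h f = h g"
      then have p: "f permutes {..<n}" "g permutes {..<n}" by (auto simp: Av_def)
      have "f i = g i" if "i < n" for i
        using arg_cong[OF hh, of "\<lambda>x. x ! i"] that by (simp add: h_def)
      then show "f = g" by (intro permutes_eqI[OF p]) simp
    qed
    have "h f \<in> perms_of_length n \<and> avoids (h f) [1, 3, 2, 4]" if "f \<in> Av n" for f
    proof -
      have f: "f permutes {..<n}" and a: "av1324 n f" using that by (auto simp: Av_def)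
      have "(\<lambda>i. f i + 1) ` {..<n} = Suc ` (f ` {..<n})" by auto
      also have "\<dots> = {1..n}" using permutes_image[OF f] by (simp add: image_Suc_lessThan)
      finally have "set (h f) = {1..n}" by (simp add: h_def atLeast0LessThan)
      moreover have "distinct (h f)"
        using permutes_inj[OF f] by (auto simp: h_def distinct_map inj_on_def)
      moreover have "avoids (h f) [1, 3, 2, 4]"
        using a unfolding avoids_def contains_1324_iff av1324_def h_def by (auto)
      ultimately show ?thesis by (simp add: perms_of_length_def h_def)
    qed
    moreover have "s \<in> h ` Av n" if "s \<in> perms_of_length n" "avoids s [1, 3, 2, 4]" for s
    proof -
      define f where "f = (\<lambda>i. if i < n then s ! i - 1 else i)"
      have s: "length s = n" "distinct s" "set s = {1..n}"
        using that(1) by (auto simp: perms_of_length_def)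
      have r: "1 \<le> s ! i \<and> s ! i \<le> n" if "i < n" for i
        using nth_mem[of i s] s that by auto
      have f: "f permutes {..<n}"
      proof (rule permutesI_less)
        show "f i < n" if "i < n" for i 
        proof -
          have "s ! i - 1 < n" using r[OF that] by linarith
          then show ?thesis using that by (simp add: f_def)
        qed
        show "inj_on f {..<n}"
        proof (rule inj_onI)
          fix i j assume "i \<in> {..<n}" "j \<in> {..<n}" "f i = f j"
          then have "s ! i = s ! j" using r[of i] r[of j] by (auto simp: f_def)
          then show "i = j" using s \<open>i \<in> {..<n}\<close> \<open>j \<in> {..<n}\<close> by (simp add: nth_eq_iff_index_eq)
        qed
      qed (simp add: f_def)
      have hf: "h f = s"
      proof (rule nth_equalityI)
        show "length (h f) = length s" by (simp add: h_def s)
        fix i assume "i < length (h f)"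
        then show "h f ! i = s ! i" using r[of i] by (simp add: h_def f_def)
      qed
      have "av1324 n f"
        unfolding av1324_def
      proof (intro allI impI notI)
        fix i j k l assume *: "i < j" "j < k" "k < l" "l < n" "f i < f k \<and> f k < f j \<and> f j < f l"
        then have "s ! i < s ! k" "s ! k < s ! j" "s ! j < s ! l"
          by (auto simp: f_def)
        with * s that(2) show False unfolding avoids_def contains_1324_iff by blast
      qed
      then show ?thesis using f hf by (auto simp: Av_def)
    qed
    ultimately show "h ` Av n = {s \<in> perms_of_length n. avoids s [1, 3, 2, 4]}" by blast
  qed
  then show ?thesis unfolding num_avoiders_def by (simp add: bij_betw_same_card)
qed

text \<open>The points of \<open>\<sigma>\<close> with the \<open>k\<close> smallest values are identified with the first \<open>k\<close> points of \<open>\<tau>\<close>;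
  both runs are decreasing. The other points of \<open>\<tau>\<close> go to the right of \<open>\<sigma>\<close>, and the other points of
  \<open>\<sigma>\<close> go above \<open>\<tau>\<close>. For \<open>k = 0\<close> this is the skew sum.\<close>

definition glue :: "nat \<Rightarrow> nat \<Rightarrow> nat \<Rightarrow> (nat \<Rightarrow> nat) \<Rightarrow> (nat \<Rightarrow> nat) \<Rightarrow> nat \<Rightarrow> nat" where
  "glue k N M \<sigma> \<tau> i =
    (if i < N then (if \<sigma> i < k then \<tau> (k - 1 - \<sigma> i) else \<sigma> i + M - k)
     else if i < N + M - k then \<tau> (i - N + k) else i)"

definition first_dec :: "nat \<Rightarrow> (nat \<Rightarrow> nat) \<Rightarrow> bool" where
  "first_dec k f \<longleftrightarrow> (\<forall>i j. i < j \<longrightarrow> j < k \<longrightarrow> f j < f i)"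

definition last_dec :: "nat \<Rightarrow> nat \<Rightarrow> (nat \<Rightarrow> nat) \<Rightarrow> bool" where
  "last_dec n k f \<longleftrightarrow> (\<forall>i j. n \<le> i + k \<longrightarrow> i < j \<longrightarrow> j < n \<longrightarrow> f j < f i)"

locale gluing =
  fixes k N M :: nat and \<sigma> \<tau> :: "nat \<Rightarrow> nat"
  assumes \<sigma>: "\<sigma> \<in> Av N" and \<tau>: "\<tau> \<in> Av M" and kN: "k \<le> N" and kM: "k \<le> M"
    and s: "first_dec k (inv \<sigma>)" and t: "first_dec k \<tau>"
begin

text \<open>\<open>V\<close> sends a value of \<sigma> to its value after gluing, \<open>P\<close> a
  position of \<tau> to its position after gluing. Both are increasing because the two identified
  runs decrease, so \<sigma> and \<tau> survive as patterns.\<close>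

definition V where "V v = (if v < k then \<tau> (k - 1 - v) else v + M - k)"
definition P where "P j = (if j < k then inv \<sigma> (k - 1 - j) else j + N - k)"

lemma \<sigma>p: "\<sigma> permutes {..<N}" and \<tau>p: "\<tau> permutes {..<M}"
  using \<sigma> \<tau> by (auto simp: Av_def)

lemma V_mono: "u < v \<Longrightarrow> V u < V v"
proof -
  assume uv: "u < v"
  have "\<tau> (k - 1 - v) > \<tau> (k - 1 - u)" if "v < k"
    using t uv that unfolding first_dec_def by auto
  moreover have "\<tau> (k - 1 - u) < M" if "u < k"
    using permutes_less[OF \<tau>p] kM that by auto
  ultimately show ?thesis using uv kM by (fastforce simp: V_def)
qed

lemma P_mono: "u < v \<Longrightarrow> P u < P v"
proof -
  assume uv: "u < v"
  have "inv \<sigma> (k - 1 - v) > inv \<sigma> (k - 1 - u)" if "v < k"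
    using s uv that unfolding first_dec_def by auto
  moreover have "inv \<sigma> (k - 1 - u) < N" if "u < k"
    using permutes_less[OF permutes_inv[OF \<sigma>p]] kN that by auto
  ultimately show ?thesis using uv kN by (fastforce simp: P_def)
qed

lemma V_iff: "V u < V v \<longleftrightarrow> u < v" and P_iff: "P u < P v \<longleftrightarrow> u < v"
  using V_mono P_mono by (metis linorder_neqE_nat order_less_asym order_less_irrefl)+

lemma glue_V: "i < N \<Longrightarrow> glue k N M \<sigma> \<tau> i = V (\<sigma> i)"
  by (simp add: glue_def V_def)

lemma glue_P: "j < M \<Longrightarrow> glue k N M \<sigma> \<tau> (P j) = \<tau> j"
proof (cases "j < k")
  case True
  have "inv \<sigma> (k - 1 - j) < N"
    using permutes_less[OF permutes_inv[OF \<sigma>p]] kN True by auto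
  then show ?thesis using True permutes_inverses(1)[OF \<sigma>p] by (simp add: glue_def P_def)
next
  case False
  assume "j < M"
  with False kM kN have "j + N - k < N + M - k" by linarith
  moreover have "\<not> j + N - k < N" "j + N - k - N + k = j" using False kN by linarith+
  ultimately show ?thesis using False unfolding glue_def P_def by simp
qed

lemma value_small:
  assumes "i < N + M - k" and "glue k N M \<sigma> \<tau> i < M"
  shows "\<exists>j<M. i = P j"
proof (cases "i < N")
  case True
  with assms have "\<sigma> i < k" by (auto simp: glue_def split: if_splits)
  then have "i = P (k - 1 - \<sigma> i)" "k - 1 - \<sigma> i < M"
    using permutes_inverses(2)[OF \<sigma>p] kM by (auto simp: P_def)
  then show ?thesis by blast
next
  case False
  then have "i = P (i - N + k)" "i - N + k < M" using assms kN by (auto simp: P_def)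
  then show ?thesis by blast
qed

lemma late_P: "N \<le> i \<Longrightarrow> i < N + M - k \<Longrightarrow> glue k N M \<sigma> \<tau> i < M"
  using permutes_less[OF \<tau>p] by (auto simp: glue_def)

lemma inj: "inj_on (glue k N M \<sigma> \<tau>) {..<N + M - k}"
proof (rule inj_onI)
  fix x y assume xy: "x \<in> {..<N + M - k}" "y \<in> {..<N + M - k}"
    "glue k N M \<sigma> \<tau> x = glue k N M \<sigma> \<tau> y"
  show "x = y"
  proof (cases "glue k N M \<sigma> \<tau> x < M")
    case True
    obtain a b where "a < M" "b < M" "x = P a" "y = P b"
      using value_small[of x] value_small[of y] xy True by auto
    moreover from this have "a = b"
      using xy(3) glue_P permutes_inj[OF \<tau>p] by (auto dest: injD)
    ultimately show ?thesis by simp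
  next
    case False
    then have "x < N" "y < N" using late_P[of x] late_P[of y] xy by force+
    then have "V (\<sigma> x) = V (\<sigma> y)" using xy(3) glue_V by simp
    then have "\<sigma> x = \<sigma> y" using V_iff by (metis linorder_neq_iff)
    then show ?thesis using permutes_inj[OF \<sigma>p] by (auto dest: injD)
  qed
qed

lemma glue_permutes: "glue k N M \<sigma> \<tau> permutes {..<N + M - k}"
proof (rule permutesI_less[OF _ _ inj])
  fix i assume i: "i < N + M - k"
  show "glue k N M \<sigma> \<tau> i < N + M - k"
  proof (cases "i < N")
    case True
    then have "\<sigma> i < N" using permutes_less[OF \<sigma>p] by simp
    moreover have "\<tau> (k - 1 - \<sigma> i) < M" if "\<sigma> i < k"
      using permutes_less[OF \<tau>p] kM that by auto
    ultimately show ?thesis using True kN kM by (fastforce simp: glue_def)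
  next
    case False
    then show ?thesis using late_P[of i] i kN by simp
  qed
qed (use kM in \<open>auto simp: glue_def\<close>)

text \<open>An occurrence of 1324 that uses a position beyond \<open>\<sigma>\<close> has its largest entry there, hence all
  of its values are below \<open>M\<close> and it lives in the copy of \<open>\<tau>\<close>.\<close>

lemma glue_Av: "glue k N M \<sigma> \<tau> \<in> Av (N + M - k)"
proof -
  let ?w = "glue k N M \<sigma> \<tau>"
  have "av1324 (N + M - k) ?w"
    unfolding av1324_def
  proof (intro allI impI notI)
    fix a b c d assume o: "a < b" "b < c" "c < d" "d < N + M - k"
      and p: "?w a < ?w c \<and> ?w c < ?w b \<and> ?w b < ?w d"
    show False
    proof (cases "d < N")
      case True
      then have "\<sigma> a < \<sigma> c" "\<sigma> c < \<sigma> b" "\<sigma> b < \<sigma> d" using o p glue_V V_iff by auto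
      with o True \<sigma> show False unfolding Av_def using av1324D by blast
    next
      case False
      then have "?w d < M" using late_P o by simp
      then obtain a' b' c' d' where "a = P a'" "b = P b'" "c = P c'" "d = P d'"
        "a' < M" "b' < M" "c' < M" "d' < M"
        using value_small[of a] value_small[of b] value_small[of c] value_small[of d] o p by auto
      with o p \<tau> show False unfolding Av_def using av1324D[of M \<tau> a' b' c' d'] glue_P P_iff by auto
    qed
  qed
  then show ?thesis using glue_permutes by (simp add: Av_def)
qed

lemma inv_glue: "v < M \<Longrightarrow> inv (glue k N M \<sigma> \<tau>) v = P (inv \<tau> v)"
proof -
  assume "v < M"
  then have "glue k N M \<sigma> \<tau> (P (inv \<tau> v)) = v"
    using glue_P permutes_less[OF permutes_inv[OF \<tau>p]] permutes_inverses(1)[OF \<tau>p] by simp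
  then show ?thesis using permutes_inj[OF glue_permutes] by (metis inv_f_f)
qed

lemma glue_bottom:
  assumes "first_dec k' (inv \<tau>)" "k' \<le> M"
  shows "first_dec k' (inv (glue k N M \<sigma> \<tau>))"
  using assms inv_glue P_mono unfolding first_dec_def by auto

lemma glue_first:
  assumes "first_dec k' \<sigma>" "k' \<le> N"
  shows "first_dec k' (glue k N M \<sigma> \<tau>)"
  using assms glue_V V_mono unfolding first_dec_def by auto

lemma glue_last:
  assumes "last_dec M k' \<tau>" "k + k' \<le> M"
  shows "last_dec (N + M - k) k' (glue k N M \<sigma> \<tau>)"
  unfolding last_dec_def
proof (intro allI impI)
  fix i j assume *: "N + M - k \<le> i + k'" "i < j" "j < N + M - k"
  then have "\<tau> (j - N + k) < \<tau> (i - N + k)"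
    using assms unfolding last_dec_def by (auto simp: less_diff_conv2)
  then show "glue k N M \<sigma> \<tau> j < glue k N M \<sigma> \<tau> i"
    using * assms(2) by (auto simp: glue_def)
qed

lemma inv_glue_big:
  assumes "M \<le> v" "v < N + M - k"
  shows "inv (glue k N M \<sigma> \<tau>) v = inv \<sigma> (v + k - M)"
proof -
  let ?x = "inv \<sigma> (v + k - M)"
  have "?x < N" using permutes_less[OF permutes_inv[OF \<sigma>p]] assms kM by auto
  moreover have "\<sigma> ?x = v + k - M" using permutes_inverses(1)[OF \<sigma>p] by simp
  moreover have "\<not> v + k - M < k" "v + k - M + M - k = v" using assms kM by linarith+
  ultimately have "glue k N M \<sigma> \<tau> ?x = v" unfolding glue_def by simp
  then show ?thesis using permutes_inj[OF glue_permutes] by (metis inv_f_f)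
qed

lemma glue_top:
  assumes "last_dec N k' (inv \<sigma>)" "k + k' \<le> N"
  shows "last_dec (N + M - k) k' (inv (glue k N M \<sigma> \<tau>))"
  unfolding last_dec_def
proof (intro allI impI)
  fix i j assume *: "N + M - k \<le> i + k'" "i < j" "j < N + M - k"
  have "inv \<sigma> (j + k - M) < inv \<sigma> (i + k - M)"
    using * assms kM unfolding last_dec_def by auto
  then show "inv (glue k N M \<sigma> \<tau>) j < inv (glue k N M \<sigma> \<tau>) i"
    using * assms(2) inv_glue_big by auto
qed

end

text \<open>The first \<open>N\<close> positions carry the pattern \<sigma>. Once \<sigma> is known,
  so are the positions \<open>P\<close> of the copy of \<tau>, where the values are those of \<tau>
  itself.\<close>

lemma glue_inj:
  assumes A: "gluing k N M \<sigma> \<tau>" and B: "gluing k N M \<sigma>' \<tau>'"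
    and eq: "glue k N M \<sigma> \<tau> = glue k N M \<sigma>' \<tau>'"
  shows "\<sigma> = \<sigma>'" "\<tau> = \<tau>'"
proof -
  interpret A: gluing k N M \<sigma> \<tau> by fact
  interpret B: gluing k N M \<sigma>' \<tau>' by fact
  show 1: "\<sigma> = \<sigma>'"
  proof (rule permutes_eqI[OF A.\<sigma>p B.\<sigma>p])
    fix i j assume "i < N" "j < N"
    then show "\<sigma> i < \<sigma> j \<longleftrightarrow> \<sigma>' i < \<sigma>' j"
      using A.glue_V B.glue_V A.V_iff B.V_iff eq by metis
  qed
  show "\<tau> = \<tau>'"
  proof (rule permutes_eqI[OF A.\<tau>p B.\<tau>p])
    fix i j assume "i < M" "j < M"
    moreover have "A.P = B.P" unfolding A.P_def B.P_def 1 ..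
    ultimately have "\<tau> i = \<tau>' i" "\<tau> j = \<tau>' j" using A.glue_P B.glue_P eq by metis+
    then show "\<tau> i < \<tau> j \<longleftrightarrow> \<tau>' i < \<tau>' j" by simp
  qed
qed

section \<open>The exponential upper bound\<close>

function red :: "(nat \<Rightarrow> nat) \<Rightarrow> nat \<Rightarrow> bool" where
  "red f i \<longleftrightarrow> \<not> (\<exists>j\<in>{..<i}. \<exists>k\<in>{..<i}. j < k \<and> red f j \<and> red f k \<and> f j < f i \<and> f i < f k)"
  by auto
termination by (relation "Wellfounded.measure snd") auto

declare red.simps [simp del]

lemma red_avoids_132:
  assumes "red f k" "red f i" "red f j" "j < k" "k < i" "f j < f i" "f i < f k"
  shows False
  using assms red.simps[of f i] by auto

text \<open>A blue entry is the 2 of a 132 whose other entries are red: let \<open>a\<close>,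
  \<open>c\<close> be such entries for \<open>y\<close>, and \<open>a'\<close>, \<open>c'\<close>
  for \<open>x\<close>. Avoiding 1324 forces \<open>a\<close> to the right of \<open>x\<close> and
  \<open>c\<close> above \<open>z\<close>. If \<open>c\<close> is above \<open>c'\<close>, then
  \<open>a'\<close>, \<open>c'\<close>, \<open>x\<close>, \<open>c\<close> form 1324; if it is
  below, then \<open>a'\<close>, \<open>c'\<close>, \<open>c\<close> form a red 132.\<close>

lemma blue_avoids_213:
  assumes f: "f \<in> Av n" and b: "\<not> red f x" "\<not> red f y" and o: "x < y" "y < z" "z < n"
    and v: "f y < f x" "f x < f z"
  shows False
proof -
  have av: "av1324 n f" using f by (simp add: Av_def)
  obtain a c where ac: "a < c" "c < y" "red f a" "red f c" "f a < f y" "f y < f c"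
    using b(2) red.simps[of f y] by auto
  obtain a' c' where ac': "a' < c'" "c' < x" "red f a'" "red f c'" "f a' < f x" "f x < f c'"
    using b(1) red.simps[of f x] by auto
  have "a \<noteq> x" using ac b by auto
  have "\<not> a < x" using av1324D[OF av, of a x y z] ac o v by auto
  then have "x < a" using \<open>a \<noteq> x\<close> by simp
  have cz: "\<not> f c < f z" using av1324D[OF av, of a c y z] ac o v by auto
  have "f c \<noteq> f c'"
    using f \<open>x < a\<close> ac ac' inj_eq[OF permutes_inj, of f] by (auto simp: Av_def)
  moreover have "\<not> f c < f c'"
    using red_avoids_132[of f c' c a'] ac ac' \<open>x < a\<close> v cz by auto
  ultimately have "f c' < f c" by simp
  then show False using av1324D[OF av, of a' c' x c] ac ac' \<open>x < a\<close> o v by auto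
qed

text \<open>An entry is a red left-to-right minimum (0), another red entry (1), a blue right-to-left
  maximum (2) or another blue entry (3). The classes listed by position and by value determine the
  permutation: read the red entries from the left and the blue ones from the right.\<close>

definition cls :: "nat \<Rightarrow> (nat \<Rightarrow> nat) \<Rightarrow> nat \<Rightarrow> nat" where
  "cls n f i =
    (if red f i then if \<forall>j<i. red f j \<longrightarrow> f i < f j then 0 else 1
     else if \<forall>j. i < j \<longrightarrow> j < n \<longrightarrow> \<not> red f j \<longrightarrow> f j < f i then 2 else 3)"

lemma cls_eq_imp_red: "cls n f i = cls n g j \<Longrightarrow> red f i \<longleftrightarrow> red g j"
  by (auto simp: cls_def split: if_splits)

definition same_words :: "nat \<Rightarrow> (nat \<Rightarrow> nat) \<Rightarrow> (nat \<Rightarrow> nat) \<Rightarrow> bool" where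
  "same_words n f g \<longleftrightarrow>
    (\<forall>i<n. cls n f i = cls n g i) \<and> (\<forall>v<n. cls n f (inv f v) = cls n g (inv g v))"

lemma same_words_sym: "same_words n f g \<Longrightarrow> same_words n g f"
  by (simp add: same_words_def)

lemma same_wordsE:
  assumes "same_words n f g" "f permutes {..<n}" "g permutes {..<n}" "i < n"
  obtains j where "j < n" "g j = f i" "cls n g j = cls n f i"
proof
  show "inv g (f i) < n"
    using permutes_less[OF permutes_inv] permutes_less assms by metis
  show "g (inv g (f i)) = f i" using permutes_inverses(1) assms by metis
  have "f i < n" using permutes_less assms by metis
  then show "cls n g (inv g (f i)) = cls n f i"
    using assms permutes_inverses(2)[OF assms(2)] by (metis same_words_def)
qed

text \<open>If \<open>i\<close> is a red left-to-right minimum, the value \<open>g i\<close> belongs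
  to such a minimum of \<open>f\<close>; it sits to the right of \<open>i\<close>, because earlier
  red entries agree, and is therefore below \<open>f i\<close>. Otherwise some red \<open>m\<close>
  before \<open>i\<close> lies below \<open>f i\<close>, the value \<open>f i\<close> occurs in
  \<open>g\<close> to the right of \<open>i\<close>, and \<open>g\<close> has a red 132.\<close>

lemma red_step:
  assumes f: "f \<in> Av n" and g: "g \<in> Av n" and w: "same_words n f g" and i: "i < n" "red f i"
    and IH: "\<And>j. j < i \<Longrightarrow> red f j \<Longrightarrow> f j = g j"
  shows "\<not> f i < g i"
proof
  assume lt: "f i < g i"
  have p: "f permutes {..<n}" "g permutes {..<n}" using f g by (auto simp: Av_def)
  have inj: "f x = f y \<Longrightarrow> x = y" "g x = g y \<Longrightarrow> x = y" for x y
    using p by (auto dest: permutes_inj injD)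
  have r: "red f j \<longleftrightarrow> red g j" if "j < n" for j
    using w that cls_eq_imp_red unfolding same_words_def by blast
  have ci: "cls n g i = cls n f i" using w i by (simp add: same_words_def)
  show False
  proof (cases "\<forall>j<i. red f j \<longrightarrow> f i < f j")
    case True
    obtain j where j: "j < n" "f j = g i" "cls n f j = cls n g i"
      using same_wordsE[OF same_words_sym[OF w] p(2,1) i(1)] .
    have c0: "cls n f j = 0" using True i ci j by (simp add: cls_def)
    then have rj: "red f j" "\<forall>m<j. red f m \<longrightarrow> f j < f m"
      by (auto simp: cls_def split: if_splits)
    have "\<not> j < i" using IH[of j] rj j inj(2)[of j i] lt by auto
    moreover have "j \<noteq> i" using j lt by auto
    ultimately have "i < j" by simp
    then have "f j < f i" using rj(2) i by simp
    then show False using j(2) lt by simp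
  next
    case False
    then obtain m where m: "m < i" "red f m" "\<not> f i < f m" by blast
    then have "f m < f i" using inj(1)[of m i] by force
    obtain j where j: "j < n" "g j = f i" "cls n g j = cls n f i"
      using same_wordsE[OF w p i(1)] .
    have rj: "red g j" using cls_eq_imp_red[OF j(3)] i by simp
    have "\<not> j < i" using IH[of j] rj r[OF j(1)] j inj(1)[of j i] lt by force
    moreover have "j \<noteq> i" using j lt by auto
    ultimately have "i < j" by simp
    show False
      using red_avoids_132[of g i j m] rj r[OF i(1)] r[of m] i m j lt IH[of m] \<open>f m < f i\<close> \<open>i < j\<close>
      by auto
  qed
qed

text \<open>The same argument read from the right: for a right-to-left maximum the value
  \<open>f i\<close> is sought in \<open>g\<close>; otherwise the value \<open>g i\<close> is sought
  in \<open>f\<close>, where it gives a 213 whose first two entries are blue.\<close>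

lemma blue_step:
  assumes f: "f \<in> Av n" and g: "g \<in> Av n" and w: "same_words n f g" and i: "i < n" "\<not> red f i"
    and IH: "\<And>j. i < j \<Longrightarrow> j < n \<Longrightarrow> \<not> red f j \<Longrightarrow> f j = g j"
  shows "\<not> f i < g i"
proof
  assume lt: "f i < g i"
  have p: "f permutes {..<n}" "g permutes {..<n}" using f g by (auto simp: Av_def)
  have inj: "f x = f y \<Longrightarrow> x = y" "g x = g y \<Longrightarrow> x = y" for x y
    using p by (auto dest: permutes_inj injD)
  have r: "red f j \<longleftrightarrow> red g j" if "j < n" for j
    using w that cls_eq_imp_red unfolding same_words_def by blast
  have ci: "cls n g i = cls n f i" using w i by (simp add: same_words_def)
  show False
  proof (cases "\<forall>j. i < j \<longrightarrow> j < n \<longrightarrow> \<not> red g j \<longrightarrow> g j < g i")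
    case True
    obtain j where j: "j < n" "g j = f i" "cls n g j = cls n f i"
      using same_wordsE[OF w p i(1)] .
    have c2: "cls n g j = 2" using True i ci j r[OF i(1)] by (simp add: cls_def)
    then have rj: "\<not> red g j" "\<forall>m. j < m \<longrightarrow> m < n \<longrightarrow> \<not> red g m \<longrightarrow> g m < g j"
      by (auto simp: cls_def split: if_splits)
    have "\<not> i < j" using IH[of j] rj r[OF j(1)] j inj(1)[of j i] lt by force
    moreover have "j \<noteq> i" using j lt by auto
    ultimately have "j < i" by simp
    then have "g i < g j" using rj(2) i r[OF i(1)] by simp
    then show False using j(2) lt by simp
  next
    case False
    then obtain m where m: "i < m" "m < n" "\<not> red g m" "\<not> g m < g i" by blast
    then have "g i < g m" using inj(2)[of m i] by force
    obtain j where j: "j < n" "f j = g i" "cls n f j = cls n g i"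
      using same_wordsE[OF same_words_sym[OF w] p(2,1) i(1)] .
    have rj: "\<not> red f j" using cls_eq_imp_red[OF j(3)] i r[OF i(1)] by simp
    have "\<not> i < j" using IH[of j] rj j inj(2)[of j i] lt by auto
    moreover have "j \<noteq> i" using j lt by auto
    ultimately have "j < i" by simp
    show False
      using blue_avoids_213[OF f rj i(2) \<open>j < i\<close> m(1,2)] j lt IH[of m] m r[of m] \<open>g i < g m\<close>
      by auto
  qed
qed

lemma same_words_eq:
  assumes f: "f \<in> Av n" and g: "g \<in> Av n" and w: "same_words n f g"
  shows "f = g"
proof
  have p: "f permutes {..<n}" "g permutes {..<n}" using f g by (auto simp: Av_def)
  have r: "red f j \<longleftrightarrow> red g j" if "j < n" for j
    using w that cls_eq_imp_red unfolding same_words_def by blast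
  have R: "i < n \<Longrightarrow> red f i \<Longrightarrow> f i = g i" for i
  proof (induction i rule: less_induct)
    case (less i)
    have "\<not> f i < g i" by (rule red_step[OF f g w]) (use less in auto)
    moreover have "\<not> g i < f i"
      by (rule red_step[OF g f same_words_sym[OF w]]) (use less r in auto)
    ultimately show ?case by simp
  qed
  have B: "i < n \<Longrightarrow> \<not> red f i \<Longrightarrow> f i = g i" for i
  proof (induction "n - i" arbitrary: i rule: less_induct)
    case less
    have "\<not> f i < g i" by (rule blue_step[OF f g w]) (use less in auto)
    moreover have "\<not> g i < f i"
      by (rule blue_step[OF g f same_words_sym[OF w]]) (use less r in auto)
    ultimately show ?case by simp
  qed
  show "f i = g i" for i
    using R[of i] B[of i] permutes_not_in[OF p(1), of i] permutes_not_in[OF p(2), of i] by (cases "i < n"; cases "red f i") auto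
qed

lemma card_Av_le: "card (Av n) \<le> 16 ^ n"
proof -
  let ?L = "{xs. set xs \<subseteq> {..<4::nat} \<and> length xs = n}"
  define h where "h f = (map (cls n f) [0..<n], map (\<lambda>v. cls n f (inv f v)) [0..<n])" for f
  have "inj_on h (Av n)"
  proof (rule inj_onI)
    fix f g assume fg: "f \<in> Av n" "g \<in> Av n" "h f = h g"
    then have "same_words n f g" unfolding h_def same_words_def by auto
    with fg show "f = g" using same_words_eq by blast
  qed
  moreover have "h ` Av n \<subseteq> ?L \<times> ?L" by (auto simp: h_def cls_def)
  moreover have "finite (?L \<times> ?L)" by (simp add: finite_lists_length_eq)
  ultimately have "card (Av n) \<le> card (?L \<times> ?L)" by (rule card_inj_on_le)
  also have "\<dots> = 16 ^ n"
    by (simp add: card_cartesian_product card_lists_length_eq flip: power_mult_distrib)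
  finally show ?thesis .
qed

section \<open>Existence of the limit\<close>

lemma id_in_Av: "id \<in> Av n"
  by (auto simp: Av_def av1324_def permutes_id)

lemma card_Av_pos: "card (Av n) \<ge> 1"
  using id_in_Av[of n] finite_Av[of n] by (metis One_nat_def Suc_leI card_gt_0_iff empty_iff)

lemma card_Av_supermult: "card (Av m) * card (Av n) \<le> card (Av (m + n))"
proof -
  have gl: "gluing 0 m n \<sigma> \<tau>" if "\<sigma> \<in> Av m" "\<tau> \<in> Av n" for \<sigma> \<tau>
    by unfold_locales (use that in \<open>auto simp: first_dec_def\<close>)
  have "inj_on (\<lambda>(\<sigma>, \<tau>). glue 0 m n \<sigma> \<tau>) (Av m \<times> Av n)"
  proof (rule inj_onI, clarify)
    fix a b c d assume "a \<in> Av m" "b \<in> Av n" "c \<in> Av m" "d \<in> Av n" "glue 0 m n a b = glue 0 m n c d"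
    then show "a = c \<and> b = d" using glue_inj[OF gl gl] by blast
  qed
  moreover have "(\<lambda>(\<sigma>, \<tau>). glue 0 m n \<sigma> \<tau>) ` (Av m \<times> Av n) \<subseteq> Av (m + n)"
    using gluing.glue_Av[OF gl] by auto
  ultimately have "card (Av m \<times> Av n) \<le> card (Av (m + n))"
    using finite_Av by (rule card_inj_on_le)
  then show ?thesis by (simp add: card_cartesian_product)
qed

text \<open>Fekete's lemma, with \<open>L\<close> the supremum of the roots. Besides convergence it
  provides the bound \<open>L ^ n\<close> for each single \<open>n\<close>, and this is what the
  counting uses.\<close>

lemma fekete_root:
  fixes a :: "nat \<Rightarrow> real"
  assumes ge1: "\<And>n. a n \<ge> 1" and sup: "\<And>m n. a m * a n \<le> a (m + n)"
    and ub: "\<And>n. a n \<le> C ^ n" and C: "C \<ge> 0"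
  shows "\<exists>L. (\<lambda>n. root n (a n)) \<longlonglongrightarrow> L \<and> (\<forall>n. a n \<le> L ^ n)"
proof -
  define S where "S = (\<lambda>n. root n (a n)) ` {1..}"
  define L where "L = Sup S"
  have bdd: "bdd_above S"
    unfolding S_def
  proof (rule bdd_aboveI2)
    fix n :: nat assume "n \<in> {1..}"
    then have "root n (a n) \<le> root n (C ^ n)" using ub by simp
    then show "root n (a n) \<le> C" using \<open>n \<in> {1..}\<close> C by (simp add: real_root_power_cancel)
  qed
  have rL: "root n (a n) \<le> L" if "n \<ge> 1" for n
    unfolding L_def by (rule cSup_upper[OF _ bdd]) (use that in \<open>auto simp: S_def\<close>)
  have aL: "a n \<le> L ^ n" for n
  proof (cases "n = 0")
    case True
    then show ?thesis using ub[of 0] by simp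
  next
    case False
    have "a n = root n (a n) ^ n" using False ge1[of n] by simp
    also have "\<dots> \<le> L ^ n"
      by (rule power_mono) (use rL[of n] False ge1[of n] in auto)
    finally show ?thesis .
  qed
  have pow: "a m ^ q \<le> a (m * q)" for m q
  proof (induction q)
    case (Suc q)
    have "a m ^ Suc q \<le> a m * a (m * q)" using Suc ge1[of m] by simp
    also have "\<dots> \<le> a (m + m * q)" by (rule sup)
    finally show ?case by simp
  qed (use ge1 in simp)
  have "(\<lambda>n. root n (a n)) \<longlonglongrightarrow> L"
  proof (rule order_tendstoI)
    fix x assume "x < L"
    moreover have "S \<noteq> {}" by (auto simp: S_def)
    ultimately have "\<exists>y\<in>S. x < y" using less_cSup_iff[OF _ bdd] by (simp add: L_def)
    then obtain m where m: "m \<ge> 1" "x < root m (a m)" by (auto simp: S_def)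
    define b where "b = root m (a m)"
    have b1: "b \<ge> 1" using ge1[of m] m unfolding b_def by simp
    have bm: "b ^ m = a m" using m ge1[of m] unfolding b_def by simp
    \<comment> \<open>Rounding \<open>n\<close> down to a multiple of \<open>m\<close> costs at most
      the factor \<open>b ^ m\<close>, whose \<open>n\<close>-th root tends to 1.\<close>
    have low: "b / root n (b ^ m) \<le> root n (a n)" if "n \<ge> 1" for n
    proof -
      have "b ^ n \<le> b ^ (m * (n div m) + m)"
        by (rule power_increasing[OF _ b1])
          (use m mod_less_divisor[of m n] mult_div_mod_eq[of m n] in linarith)
      also have "\<dots> = a m ^ (n div m) * b ^ m" by (simp add: power_add power_mult bm)
      also have "\<dots> \<le> a n * b ^ m"
      proof (rule mult_right_mono)
        have "a m ^ (n div m) \<le> a (m * (n div m)) * 1" using pow by simp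
        also have "\<dots> \<le> a (m * (n div m)) * a (n mod m)"
          using ge1 by (intro mult_left_mono) (auto intro: order_trans[OF zero_le_one])
        also have "\<dots> \<le> a n" using sup[of "m * (n div m)" "n mod m"] by simp
        finally show "a m ^ (n div m) \<le> a n" .
      qed (use b1 in simp)
      finally have "b ^ n / b ^ m \<le> a n" using b1 by (simp add: field_simps)
      then have "root n (b ^ n / b ^ m) \<le> root n (a n)" using that by simp
      then show ?thesis using that b1 by (simp add: real_root_divide real_root_power_cancel)
    qed
    have "(\<lambda>n. b / root n (b ^ m)) \<longlonglongrightarrow> b / 1"
      by (intro tendsto_intros LIMSEQ_root_const) (use b1 in auto)
    then have "eventually (\<lambda>n. x < b / root n (b ^ m)) sequentially"
      using m(2) by (auto simp: b_def intro: order_tendstoD)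
    then show "eventually (\<lambda>n. x < root n (a n)) sequentially"
      using eventually_ge_at_top[of 1]
      by eventually_elim (use low in \<open>auto intro: order_less_le_trans\<close>)
  next
    fix x assume "L < x"
    show "eventually (\<lambda>n. root n (a n) < x) sequentially"
      by (rule eventually_mono[OF eventually_ge_at_top[of 1]])
        (use rL \<open>L < x\<close> le_less_trans in blast)
  qed
  with aL show ?thesis by blast
qed

lemma growth_rate_bound: "real (card (Av n)) \<le> growth_rate [1, 3, 2, 4] ^ n"
proof -
  have "\<exists>L. (\<lambda>n. root n (real (card (Av n)))) \<longlonglongrightarrow> L \<and> (\<forall>n. real (card (Av n)) \<le> L ^ n)"
  proof (rule fekete_root)
    show "1 \<le> real (card (Av n))" for n using card_Av_pos[of n] by simp
    show "real (card (Av m)) * real (card (Av n)) \<le> real (card (Av (m + n)))" for m n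
      using card_Av_supermult[of m n] by (metis of_nat_le_iff of_nat_mult)
    show "real (card (Av n)) \<le> 16 ^ n" for n
      using card_Av_le[of n] by (metis of_nat_le_iff of_nat_numeral of_nat_power)
  qed simp
  then show ?thesis unfolding growth_rate_def num_avoiders_eq using limI by blast
qed

section \<open>Chains of glued blocks\<close>

text \<open>Reverse-complement, the rotation by a half turn.\<close>

definition rc :: "nat \<Rightarrow> (nat \<Rightarrow> nat) \<Rightarrow> nat \<Rightarrow> nat" where
  "rc n f i = (if i < n then n - 1 - f (n - 1 - i) else i)"

lemma rc_permutes:
  assumes f: "f permutes {..<n}"
  shows "rc n f permutes {..<n}"
proof (rule permutesI_less)
  show "inj_on (rc n f) {..<n}"
  proof (rule inj_onI)
    fix i j assume ij: "i \<in> {..<n}" "j \<in> {..<n}" "rc n f i = rc n f j"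
    have "f (n - 1 - i) < n" "f (n - 1 - j) < n" using permutes_less[OF f] ij by auto
    then have "f (n - 1 - i) = f (n - 1 - j)" using ij by (auto simp: rc_def)
    then have "n - 1 - i = n - 1 - j" using permutes_inj[OF f] by (auto dest: injD)
    then show "i = j" using ij by auto
  qed
qed (auto simp: rc_def)

lemma rc_less_iff:
  assumes f: "f permutes {..<n}" and "i < n" "j < n"
  shows "rc n f i < rc n f j \<longleftrightarrow> f (n - 1 - j) < f (n - 1 - i)"
proof -
  have "f (n - 1 - i) < n" "f (n - 1 - j) < n" using permutes_less[OF f] assms by auto
  then show ?thesis using assms by (auto simp: rc_def)
qed

lemma rc_rc:
  assumes f: "f permutes {..<n}"
  shows "rc n (rc n f) = f"
proof
  fix i
  show "rc n (rc n f) i = f i"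
  proof (cases "i < n")
    case True
    then have "f i < n" using permutes_less[OF f] by simp
    moreover have "n - 1 - (n - 1 - i) = i" using True by simp
    ultimately show ?thesis using True by (simp add: rc_def)
  qed (use permutes_not_in[OF f] in \<open>simp add: rc_def\<close>)
qed

lemma inv_rc:
  assumes f: "f permutes {..<n}"
  shows "inv (rc n f) = rc n (inv f)"
proof (rule inv_unique_comp)
  have *: "rc n p (rc n (inv p) i) = i" if p: "p permutes {..<n}" for p i
  proof (cases "i < n")
    case True
    have "inv p (n - 1 - i) < n" using permutes_less[OF permutes_inv[OF p]] True by auto
    then have "n - 1 - (n - 1 - inv p (n - 1 - i)) = inv p (n - 1 - i)" by simp
    then show ?thesis using True permutes_inverses(1)[OF p] by (simp add: rc_def)
  qed (simp add: rc_def)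
  show "rc n f \<circ> rc n (inv f) = id" using *[OF f] by auto
  show "rc n (inv f) \<circ> rc n f = id"
    using *[OF permutes_inv[OF f]] permutes_inv_inv[OF f] by auto
qed

lemma rc_Av:
  assumes "f \<in> Av n"
  shows "rc n f \<in> Av n"
proof -
  have f: "f permutes {..<n}" and a: "av1324 n f" using assms by (auto simp: Av_def)
  have "av1324 n (rc n f)"
    unfolding av1324_def
  proof (intro allI impI notI)
    fix i j k l assume *: "i < j" "j < k" "k < l" "l < n"
      "rc n f i < rc n f k \<and> rc n f k < rc n f j \<and> rc n f j < rc n f l"
    then have "f (n - 1 - k) < f (n - 1 - i)" "f (n - 1 - j) < f (n - 1 - k)"
      "f (n - 1 - l) < f (n - 1 - j)"
      using rc_less_iff[OF f] by simp_all
    then show False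
      using av1324D[OF a, of "n - 1 - l" "n - 1 - k" "n - 1 - j" "n - 1 - i"] * by force
  qed
  then show ?thesis using rc_permutes[OF f] by (simp add: Av_def)
qed

lemma rc_first_dec:
  assumes f: "f permutes {..<n}" and "last_dec n k f" "k \<le> n"
  shows "first_dec k (rc n f)"
  unfolding first_dec_def
proof (intro allI impI)
  fix i j assume "i < j" "j < k"
  then show "rc n f j < rc n f i"
    using assms rc_less_iff[OF f, of j i] unfolding last_dec_def by auto
qed

lemma rc_last_dec:
  assumes f: "f permutes {..<n}" and "first_dec k f" "k \<le> n"
  shows "last_dec n k (rc n f)"
  unfolding last_dec_def
proof (intro allI impI)
  fix i j assume "n \<le> i + k" "i < j" "j < n"
  then show "rc n f j < rc n f i"
    using assms rc_less_iff[OF f, of j i] unfolding first_dec_def by auto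
qed

lemma inv_Av:
  assumes "f \<in> Av n"
  shows "inv f \<in> Av n"
proof -
  have f: "f permutes {..<n}" and a: "av1324 n f" using assms by (auto simp: Av_def)
  have "av1324 n (inv f)"
    unfolding av1324_def
  proof (intro allI impI notI)
    fix i j k l assume *: "i < j" "j < k" "k < l" "l < n"
      "inv f i < inv f k \<and> inv f k < inv f j \<and> inv f j < inv f l"
    then show False
      using av1324D[OF a, of "inv f i" "inv f k" "inv f j" "inv f l"] permutes_inverses(1)[OF f]
        permutes_less[OF permutes_inv[OF f]] by auto
  qed
  then show ?thesis using permutes_inv[OF f] by (simp add: Av_def)
qed

section \<open>Chains of permutations with runs on their edges\<close>

definition dec_ends :: "nat \<Rightarrow> nat \<Rightarrow> nat \<Rightarrow> (nat \<Rightarrow> nat) set" where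
  "dec_ends k k' n = {f \<in> Av n. first_dec k f \<and> last_dec n k' f}"

text \<open>Runs of equal length on the left and on the bottom edge, the two edges that
  \<open>glue\<close> joins, so that such permutations can be chained at will.\<close>

definition dec_corner :: "nat \<Rightarrow> nat \<Rightarrow> (nat \<Rightarrow> nat) set" where
  "dec_corner k n = {f \<in> Av n. first_dec k f \<and> first_dec k (inv f)}"

lemma finite_dec_corner: "finite (dec_corner k n)" and finite_dec_ends: "finite (dec_ends k k' n)"
  using finite_Av[of n] by (auto simp: dec_corner_def dec_ends_def)

text \<open>The inverse of one element is glued to another one; the inverse makes both cells next to each run
  correspond to the same cell of the block, so that unequal cell sizes do no harm later on.\<close>

lemma card_dec_ends_corner:
  assumes "k + k' \<le> n"
  shows "card (dec_ends k k' n) ^ 2 \<le> card (dec_corner k' (2 * n - k))"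
proof -
  define h where "h = (\<lambda>(a, b). rc (2 * n - k) (glue k n n (inv a) b))"
  have gl: "gluing k n n (inv a) b" if "a \<in> dec_ends k k' n" "b \<in> dec_ends k k' n" for a b
  proof -
    have "inv (inv a) = a" using that permutes_inv_inv[of a "{..<n}"] by (auto simp: dec_ends_def Av_def)
    then show ?thesis using that assms inv_Av by unfold_locales (auto simp: dec_ends_def)
  qed
  have "inj_on h (dec_ends k k' n \<times> dec_ends k k' n)"
  proof (rule inj_onI, clarify)
    fix a b c d assume *: "a \<in> dec_ends k k' n" "b \<in> dec_ends k k' n" "c \<in> dec_ends k k' n" "d \<in> dec_ends k k' n"
      and eq: "h (a, b) = h (c, d)"
    have p: "a permutes {..<n}" "c permutes {..<n}" using * by (auto simp: dec_ends_def Av_def)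
    have "glue k n n (inv a) b = glue k n n (inv c) d"
      using eq rc_rc[OF gluing.glue_permutes[OF gl]] * unfolding h_def
      by (metis case_prod_conv mult_2)
    then have "inv a = inv c" "b = d" using glue_inj[OF gl gl] * by blast+
    then show "a = c \<and> b = d" using permutes_inv_inv p by metis
  qed
  moreover have "h ` (dec_ends k k' n \<times> dec_ends k k' n) \<subseteq> dec_corner k' (2 * n - k)"
  \<comment> \<open>The free run of \<open>b\<close> lies on the right edge and that of
    \<open>inv a\<close> on the top edge; the half turn brings them to the left and to the
    bottom.\<close>
  proof clarify
    fix a b assume *: "a \<in> dec_ends k k' n" "b \<in> dec_ends k k' n"
    interpret gluing k n n "inv a" b by (rule gl[OF *])
    let ?w = "glue k n n (inv a) b"
    have sz: "n + n - k = 2 * n - k" by simp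
    have "inv (inv a) = a" using * permutes_inv_inv[of a "{..<n}"] by (auto simp: dec_ends_def Av_def)
    then have "last_dec (2 * n - k) k' ?w" "last_dec (2 * n - k) k' (inv ?w)"
      using glue_last glue_top * assms unfolding dec_ends_def sz by auto
    moreover have p: "?w permutes {..<2 * n - k}" using glue_permutes sz by simp
    moreover have "k' \<le> 2 * n - k" using assms by simp
    ultimately have "first_dec k' (rc (2 * n - k) ?w)" "first_dec k' (inv (rc (2 * n - k) ?w))"
      using rc_first_dec permutes_inv[OF p] inv_rc[OF p] by auto
    then show "h (a, b) \<in> dec_corner k' (2 * n - k)"
      using rc_Av glue_Av sz by (simp add: dec_corner_def h_def)
  qed
  ultimately have "card (dec_ends k k' n \<times> dec_ends k k' n) \<le> card (dec_corner k' (2 * n - k))"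
    using finite_dec_corner by (rule card_inj_on_le)
  then show ?thesis by (simp add: card_cartesian_product power2_eq_square)
qed

text \<open>Gluing uses up the bottom run of the first permutation and the left run of the second;
  the other two remain, so the result can be glued again.\<close>

lemma card_dec_corner_mult:
  assumes "k \<le> m" "k \<le> n"
  shows "card (dec_corner k m) * card (dec_corner k n) \<le> card (dec_corner k (m + n - k))"
proof -
  define h where "h = (\<lambda>(a, b). glue k m n a b)"
  have gl: "gluing k m n a b" if "a \<in> dec_corner k m" "b \<in> dec_corner k n" for a b
    by unfold_locales (use that assms in \<open>auto simp: dec_corner_def\<close>)
  have "inj_on h (dec_corner k m \<times> dec_corner k n)"
    using glue_inj[OF gl gl] by (intro inj_onI) (auto simp: h_def)
  moreover have "h ` (dec_corner k m \<times> dec_corner k n) \<subseteq> dec_corner k (m + n - k)"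
  proof clarify
    fix a b assume *: "a \<in> dec_corner k m" "b \<in> dec_corner k n"
    interpret gluing k m n a b by (rule gl[OF *])
    show "h (a, b) \<in> dec_corner k (m + n - k)"
      using glue_Av glue_first glue_bottom * assms by (auto simp: dec_corner_def h_def)
  qed
  ultimately have "card (dec_corner k m \<times> dec_corner k n) \<le> card (dec_corner k (m + n - k))"
    using finite_dec_corner by (rule card_inj_on_le)
  then show ?thesis by (simp add: card_cartesian_product)
qed

lemma card_dec_corner_power:
  assumes "k \<le> n"
  shows "card (dec_corner k n) ^ Suc m \<le> card (dec_corner k (n + m * (n - k)))"
proof (induction m)
  case (Suc m)
  have "card (dec_corner k n) ^ Suc (Suc m) \<le> card (dec_corner k n) * card (dec_corner k (n + m * (n - k)))"
    using Suc by simp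
  also have "\<dots> \<le> card (dec_corner k (n + (n + m * (n - k)) - k))"
    using assms by (intro card_dec_corner_mult) auto
  also have "n + (n + m * (n - k)) - k = n + Suc m * (n - k)" using assms by simp
  finally show ?case .
qed simp

text \<open>Comparing all powers makes a constant factor disappear; this removes the boundary effect
  of a finite chain.\<close>

lemma le_of_power_le:
  fixes x y C :: real
  assumes le: "\<And>m. x ^ Suc m \<le> C * y ^ Suc m" and y: "y > 0"
  shows "x \<le> y"
proof (rule ccontr)
  assume "\<not> x \<le> y"
  then have "1 < x / y" using y by simp
  then obtain n where n: "C < (x / y) ^ n" using real_arch_pow by blast
  also have "(x / y) ^ n \<le> (x / y) ^ Suc n"
    by (rule power_increasing) (use \<open>1 < x / y\<close> in auto)
  finally have "C * y ^ Suc n < x ^ Suc n"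
    using y by (simp add: power_divide field_simps)
  then show False using le[of n] by simp
qed

lemma growth_rate_ge_1: "growth_rate [1, 3, 2, 4] \<ge> 1"
  using growth_rate_bound[of 1] card_Av_pos[of 1] by simp

text \<open>A pair of blocks shares a run of length \<open>k\<close> inside and one of length
  \<open>k'\<close> with the next pair. A chain of \<open>m + 1\<close> pairs thus has
  \<open>k' + (m + 1) * (2 * n - k - k')\<close> points, and the single \<open>k'\<close> only
  contributes the constant factor.\<close>

lemma card_dec_ends_bound:
  assumes n: "k + k' \<le> n"
  shows "real (card (dec_ends k k' n)) ^ 2 \<le> growth_rate [1, 3, 2, 4] ^ (2 * n - k - k')"
proof (rule le_of_power_le)
  let ?g = "growth_rate [1, 3, 2, 4]" and ?e = "card (dec_ends k k' n)" and ?L = "2 * n - k"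
  show "?g ^ (2 * n - k - k') > 0" using growth_rate_ge_1 by simp
  fix m
  have "(?e ^ 2) ^ Suc m \<le> card (dec_corner k' ?L) ^ Suc m"
    by (rule power_mono[OF card_dec_ends_corner[OF n]]) simp
  also have "\<dots> \<le> card (dec_corner k' (?L + m * (?L - k')))"
    using n by (intro card_dec_corner_power) simp
  also have "\<dots> \<le> card (Av (?L + m * (?L - k')))"
    by (rule card_mono[OF finite_Av]) (auto simp: dec_corner_def)
  finally have "real ((?e ^ 2) ^ Suc m) \<le> real (card (Av (?L + m * (?L - k'))))"
    by (simp only: of_nat_le_iff)
  also have "\<dots> \<le> ?g ^ (?L + m * (?L - k'))" by (rule growth_rate_bound)
  also have "?L + m * (?L - k') = k' + Suc m * (?L - k')" using n by simp
  also have "?g ^ \<dots> = ?g ^ k' * (?g ^ (?L - k')) ^ Suc m"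
    by (simp add: power_add power_mult mult.commute flip: power_mult)
  finally show "(real ?e ^ 2) ^ Suc m \<le> ?g ^ k' * (?g ^ (2 * n - k - k')) ^ Suc m" by simp
qed

section \<open>Inserting decreasing runs around a domino\<close>

text \<open>In a domino the values from \<open>q\<close> on form the top cell and the values below \<open>q\<close> the bottom cell.\<close>

definition top213 :: "nat \<Rightarrow> nat \<Rightarrow> (nat \<Rightarrow> nat) \<Rightarrow> bool" where
  "top213 n q f \<longleftrightarrow> (\<forall>i j l. i < j \<longrightarrow> j < l \<longrightarrow> l < n \<longrightarrow> q \<le> f j \<longrightarrow> \<not> (f j < f i \<and> f i < f l))"

text \<open>For both cells the middle position is compared with \<open>q\<close>: it holds the
  lowest entry of a 213 and the highest of a 132, so this places the whole pattern in one
  cell.\<close>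

definition bot132 :: "nat \<Rightarrow> nat \<Rightarrow> (nat \<Rightarrow> nat) \<Rightarrow> bool" where
  "bot132 n q f \<longleftrightarrow> (\<forall>i j l. i < j \<longrightarrow> j < l \<longrightarrow> l < n \<longrightarrow> f j < q \<longrightarrow> \<not> (f i < f l \<and> f l < f j))"

definition dominoes :: "nat \<Rightarrow> nat \<Rightarrow> (nat \<Rightarrow> nat) set" where
  "dominoes n q = {f \<in> Av n. top213 n q f \<and> bot132 n q f}"

lemma finite_dominoes: "finite (dominoes n q)"
  using finite_Av[of n] by (simp add: dominoes_def)

lemma rc_top213:
  assumes f: "f permutes {..<n}" and b: "bot132 n q f" and "q \<le> n"
  shows "top213 n (n - q) (rc n f)"
  unfolding top213_def
proof (intro allI impI notI)
  fix i j l assume *: "i < j" "j < l" "l < n" "n - q \<le> rc n f j"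
    "rc n f j < rc n f i \<and> rc n f i < rc n f l"
  have "f (n - 1 - l) < f (n - 1 - i)" "f (n - 1 - i) < f (n - 1 - j)"
    using * rc_less_iff[OF f] by simp_all
  moreover have "f (n - 1 - j) < q"
    using * \<open>q \<le> n\<close> permutes_less[OF f, of "n - 1 - j"] by (auto simp: rc_def)
  moreover have "n - 1 - l < n - 1 - j" "n - 1 - j < n - 1 - i" "n - 1 - i < n" using * by auto
  ultimately show False using b unfolding bot132_def by blast
qed

definition ins :: "nat \<Rightarrow> nat \<Rightarrow> nat set \<Rightarrow> (nat \<Rightarrow> nat) \<Rightarrow> nat \<Rightarrow> nat" where
  "ins n k A e i =
    (if i < k then sorted_list_of_set A ! (k - 1 - i)
     else if i < n + k then sorted_list_of_set ({..<n + k} - A) ! e (i - k) else i)"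

locale inserting =
  fixes n k q :: nat and A :: "nat set" and e :: "nat \<Rightarrow> nat"
  assumes e: "e \<in> Av n" and q: "q \<le> n" and top: "top213 n q e"
    and A: "A \<subseteq> {q..<n + k}" and cA: "card A = k"
begin

abbreviation "xs \<equiv> sorted_list_of_set A"
abbreviation "ys \<equiv> sorted_list_of_set ({..<n + k} - A)"

lemma ep: "e permutes {..<n}" using e by (simp add: Av_def)

lemma finA: "finite A" using A finite_subset by blast

lemma len: "length xs = k" "length ys = n"
proof -
  have "A \<subseteq> {..<n + k}" using A by auto
  then show "length xs = k" "length ys = n"
    using cA finA by (simp_all add: card_Diff_subset)
qed

lemma set_lists: "set xs = A" "set ys = {..<n + k} - A"
  using finA by simp_all

lemma xs_less: "i < j \<Longrightarrow> j < k \<Longrightarrow> xs ! i < xs ! j"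
  using sorted_wrt_nth_less[OF strict_sorted_list_of_set] len by metis

lemma ys_less: "i < j \<Longrightarrow> j < n \<Longrightarrow> ys ! i < ys ! j"
  using sorted_wrt_nth_less[OF strict_sorted_list_of_set] len by metis

lemma ys_less_iff: "i < n \<Longrightarrow> j < n \<Longrightarrow> ys ! i < ys ! j \<longleftrightarrow> i < j"
  using ys_less by (metis linorder_neqE_nat order_less_asym order_less_irrefl)

lemma ys_ge: "i < n \<Longrightarrow> i \<le> ys ! i"
proof (induction i)
  case (Suc i)
  then show ?case using ys_less[of i "Suc i"] by simp
qed simp

lemma ys_small: "i < q \<Longrightarrow> ys ! i = i"
proof (induction i rule: less_induct)
  case (less i)
  then have "i \<in> set ys" using A q set_lists by auto
  then obtain j where j: "j < n" "ys ! j = i" using len(2) by (metis in_set_conv_nth)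
  then have "j \<le> i" using ys_ge by auto
  with j less.IH[of j] less.prems show ?case by (cases "j = i") auto
qed

lemma ys_ge_q: "i < n \<Longrightarrow> q \<le> ys ! i \<Longrightarrow> q \<le> i"
  using ys_small[of i] by force

lemma xs_in: "i < k \<Longrightarrow> xs ! i \<in> A" and ys_in: "i < n \<Longrightarrow> ys ! i \<in> {..<n + k} - A"
  using set_lists len nth_mem by metis+

abbreviation "E \<equiv> ins n k A e"

lemma E_left: "i < k \<Longrightarrow> E i \<in> A"
  using xs_in[of "k - 1 - i"] by (simp add: ins_def)

lemma E_right: "k \<le> i \<Longrightarrow> i < n + k \<Longrightarrow> E i = ys ! e (i - k)"
  by (simp add: ins_def)

lemma e_less: "k \<le> i \<Longrightarrow> i < n + k \<Longrightarrow> e (i - k) < n"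
  using permutes_less[OF ep, of "i - k"] by auto

lemma E_right_less_iff:
  "k \<le> i \<Longrightarrow> i < n + k \<Longrightarrow> k \<le> j \<Longrightarrow> j < n + k \<Longrightarrow> E i < E j \<longleftrightarrow> e (i - k) < e (j - k)"
  using E_right e_less ys_less_iff by simp

lemma E_first_dec: "first_dec k E"
  unfolding first_dec_def ins_def using xs_less by auto

lemma E_permutes: "E permutes {..<n + k}"
proof (rule permutesI_less)
  show "inj_on E {..<n + k}"
  proof (rule inj_onI)
    fix i j assume ij: "i \<in> {..<n + k}" "j \<in> {..<n + k}" "E i = E j"
    have "i < k \<longleftrightarrow> j < k"
      using ij E_left[of i] E_left[of j] E_right[of i] E_right[of j] e_less[of i] e_less[of j]
        ys_in[of "e (i - k)"] ys_in[of "e (j - k)"] by (cases "i < k"; cases "j < k") auto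
    moreover have "i = j" if "i < k" "j < k"
    proof -
      have dec: "E b < E a" if "a < b" "b < k" for a b
        using E_first_dec that by (auto simp: first_dec_def)
      show ?thesis using dec[of i j] dec[of j i] ij(3) that by (cases i j rule: linorder_cases) auto
    qed
    moreover have "i = j" if "k \<le> i" "k \<le> j"
    proof -
      have "\<not> e (i - k) < e (j - k)" "\<not> e (j - k) < e (i - k)"
        using E_right_less_iff[of i j] E_right_less_iff[of j i] ij that by auto
      then have "e (i - k) = e (j - k)" by simp
      then have "i - k = j - k" using permutes_inj[OF ep] by (auto dest: injD)
      then show ?thesis using that by simp
    qed
    ultimately show "i = j" by force
  qed
  fix i assume "i < n + k"
  then show "E i < n + k"
    using E_left[of i] E_right[of i] A ys_in[OF e_less[of i]] by (cases "i < k") auto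
qed (simp add: ins_def)

text \<open>Since the run decreases, only the 1 of a 1324 can lie in it. The entries 3, 2, 4 are
  then above a value of the run, hence form a 213 in the top cell.\<close>

lemma E_Av: "E \<in> Av (n + k)"
proof -
  have "av1324 (n + k) E"
    unfolding av1324_def
  proof (intro allI impI notI)
    fix a b c d assume o: "a < b" "b < c" "c < d" "d < n + k"
      and p: "E a < E c \<and> E c < E b \<and> E b < E d"
    have b: "k \<le> b"
    proof (rule ccontr)
      assume "\<not> k \<le> b"
      then have "E b < E a" using E_first_dec o by (auto simp: first_dec_def)
      then show False using p by auto
    qed
    have lt: "e (c - k) < e (b - k)" "e (b - k) < e (d - k)"
      using p o b E_right_less_iff by auto
    have pos: "b - k < c - k" "c - k < d - k" "d - k < n" using o b by auto
    show False
    proof (cases "k \<le> a")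
      case True
      then have "e (a - k) < e (c - k)" "a - k < b - k" using p o b E_right_less_iff by auto
      then show False using e lt pos unfolding Av_def using av1324D by blast
    next
      case False
      then have "q \<le> E c" using E_left[of a] A p by force
      then have "q \<le> e (c - k)" using E_right[of c] e_less[of c] ys_ge_q o b by auto
      then show False using top lt pos unfolding top213_def by blast
    qed
  qed
  then show ?thesis using E_permutes by (simp add: Av_def)
qed

lemma E_small: "i < n + k \<Longrightarrow> E i < q \<Longrightarrow> k \<le> i \<and> e (i - k) < q"
  using E_left[of i] A E_right[of i] ys_ge[OF e_less[of i]] by (cases "i < k") auto

lemma E_bot132:
  assumes "bot132 n q e"
  shows "bot132 (n + k) q E"
  unfolding bot132_def
proof (intro allI impI notI)
  fix i j l assume *: "i < j" "j < l" "l < n + k" "E j < q" "E i < E l \<and> E l < E j"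
  have "k \<le> i" "k \<le> j" "k \<le> l" "e (j - k) < q" using E_small * by force+
  moreover have "e (i - k) < e (l - k)" "e (l - k) < e (j - k)"
    using * E_right_less_iff \<open>k \<le> i\<close> \<open>k \<le> l\<close> \<open>k \<le> j\<close> by auto
  moreover have "i - k < j - k" "j - k < l - k" "l - k < n" using * calculation by auto
  ultimately show False using assms unfolding bot132_def by blast
qed

lemma E_last_dec:
  assumes "last_dec n m e" "m \<le> n"
  shows "last_dec (n + k) m E"
  unfolding last_dec_def
proof (intro allI impI)
  fix i j assume *: "n + k \<le> i + m" "i < j" "j < n + k"
  then have "e (j - k) < e (i - k)" using assms unfolding last_dec_def by auto
  then show "E j < E i" using E_right_less_iff[of j i] * assms by auto
qed

lemma A_eq: "A = E ` {..<k}"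
proof -
  have "E ` {..<k} \<subseteq> A" using E_left by auto
  moreover have "card (E ` {..<k}) = k"
    using card_image[OF inj_on_subset[OF permutes_inj[OF E_permutes]], of "{..<k}"] by simp
  ultimately show ?thesis using card_subset_eq[OF finA] cA by metis
qed

end

lemma ins_inj:
  assumes "inserting n k q A e" "inserting n k q B f" and eq: "ins n k A e = ins n k B f"
  shows "A = B" "e = f"
proof -
  interpret A: inserting n k q A e by fact
  interpret B: inserting n k q B f by fact
  show "A = B" using A.A_eq B.A_eq eq by simp
  show "e = f"
  proof (rule permutes_eqI[OF A.ep B.ep])
    fix i j assume "i < n" "j < n"
    then show "e i < e j \<longleftrightarrow> f i < f j"
      using A.E_right_less_iff[of "i + k" "j + k"] B.E_right_less_iff[of "i + k" "j + k"] eq by simp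
  qed
qed

text \<open>The binomial coefficient counts the value sets of the run, which share the upper
  \<open>n - q + k\<close> values freely with the top cell. The target \<open>Y\<close> is left
  open, as the two insertions have to preserve different properties.\<close>

lemma card_ins:
  assumes q: "q \<le> n" and X: "X \<subseteq> {e \<in> Av n. top213 n q e}"
    and Y: "\<And>A e. e \<in> X \<Longrightarrow> inserting n k q A e \<Longrightarrow> ins n k A e \<in> Y" and "finite Y"
  shows "card X * (n - q + k choose k) \<le> card Y"
proof -
  let ?S = "{A. A \<subseteq> {q..<n + k} \<and> card A = k}"
  have I: "inserting n k q A e" if "A \<in> ?S" "e \<in> X" for A e
    using that q X by unfold_locales auto
  have "inj_on (\<lambda>(e, A). ins n k A e) (X \<times> ?S)"
    using ins_inj[OF I I] by (intro inj_onI) auto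
  moreover have "(\<lambda>(e, A). ins n k A e) ` (X \<times> ?S) \<subseteq> Y"
    using Y I by auto
  ultimately have "card (X \<times> ?S) \<le> card Y" using \<open>finite Y\<close> by (rule card_inj_on_le)
  moreover have "card ?S = (n - q + k choose k)" using q n_subsets[of "{q..<n + k}" k] by simp
  ultimately show ?thesis by (simp add: card_cartesian_product)
qed

text \<open>The half turn exchanges the two cells and moves the first run to the right edge; a
  second insertion on the left then serves the former bottom cell.\<close>

lemma card_domino_dec_ends:
  assumes q: "q \<le> n"
  shows "card (dominoes n q) * (n - q + k choose k) * (q + k' choose k') \<le> card (dec_ends k' k (n + k + k'))"
proof -
  let ?N = "n + k"
  define Y where "Y = {f \<in> Av ?N. first_dec k f \<and> bot132 ?N q f}"
  define Z where "Z = rc ?N ` Y"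
  have "card (dominoes n q) * (n - q + k choose k) \<le> card Y"
  proof (rule card_ins[OF q])
    fix A e assume "e \<in> dominoes n q" "inserting n k q A e"
    then show "ins n k A e \<in> Y"
      using inserting.E_Av inserting.E_first_dec inserting.E_bot132 by (auto simp: Y_def dominoes_def)
  qed (use finite_Av[of ?N] in \<open>auto simp: dominoes_def Y_def\<close>)
  also have "card Y = card Z"
    unfolding Z_def
  proof (rule card_image[symmetric], rule inj_onI)
    fix f g assume "f \<in> Y" "g \<in> Y" and eq: "rc ?N f = rc ?N g"
    then have p: "f permutes {..<?N}" "g permutes {..<?N}" by (auto simp: Y_def Av_def)
    show "f = g" using arg_cong[OF eq, of "rc ?N"] unfolding rc_rc[OF p(1)] rc_rc[OF p(2)] .
  qed
  finally have 1: "card (dominoes n q) * (n - q + k choose k) \<le> card Z" .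
  have Z: "f \<in> Av ?N" "last_dec ?N k f" "top213 ?N (?N - q) f" if "f \<in> Z" for f
    using that rc_Av rc_last_dec rc_top213 q unfolding Z_def Y_def
    by (auto simp: Av_def)
  \<comment> \<open>The new bottom cell has \<open>?N - q\<close> values: those of the former top
    cell and of the first run.\<close>
  have "card Z * (?N - (?N - q) + k' choose k') \<le> card (dec_ends k' k (?N + k'))"
  proof (rule card_ins)
    fix A e assume "e \<in> Z" "inserting ?N k' (?N - q) A e"
    then show "ins ?N k' A e \<in> dec_ends k' k (?N + k')"
      using inserting.E_Av inserting.E_first_dec inserting.E_last_dec Z by (auto simp: dec_ends_def)
  qed (use Z finite_dec_ends in auto)
  moreover have "?N - (?N - q) = q" using q by simp
  ultimately have "card Z * (q + k' choose k') \<le> card (dec_ends k' k (?N + k'))" by simp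
  with mult_le_mono1[OF 1] show ?thesis by (rule order_trans)
qed

section \<open>Building dominoes\<close>

lemma dominoesD:
  assumes "f \<in> dominoes n q"
  shows "f permutes {..<n}" "av1324 n f" "top213 n q f" "bot132 n q f"
  using assms by (auto simp: dominoes_def Av_def)

text \<open>The values at which a new leftmost top entry can be inserted into a domino.\<close>

definition slots :: "nat \<Rightarrow> nat \<Rightarrow> (nat \<Rightarrow> nat) \<Rightarrow> nat set" where
  "slots n q f = {v. q \<le> v \<and> v \<le> n \<and>
     (\<forall>i j. i < j \<longrightarrow> j < n \<longrightarrow> q \<le> f i \<longrightarrow> \<not> (f i < v \<and> v \<le> f j))}"

lemma finite_slots: "finite (slots n q f)"
  by (rule finite_subset[of _ "{..n}"]) (auto simp: slots_def)

text \<open>\<open>f\<close>, then one entry \<open>b\<close>, then \<open>g\<close>; by decreasing value: top of \<open>f\<close>, top of \<open>g\<close>, \<open>b\<close>, bottom of \<open>f\<close>,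
  bottom of \<open>g\<close>.\<close>

definition br :: "nat \<Rightarrow> nat \<Rightarrow> nat \<Rightarrow> nat \<Rightarrow> (nat \<Rightarrow> nat) \<Rightarrow> (nat \<Rightarrow> nat) \<Rightarrow> nat \<Rightarrow> nat" where
  "br na qa nb qb f g i =
    (if i < na then (if f i < qa then f i + qb else f i + nb + 1)
     else if i = na then qa + qb
     else if i < na + nb + 1 then
       (if g (i - na - 1) < qb then g (i - na - 1) else g (i - na - 1) + qa + 1)
     else i)"

text \<open>The middle entry is the highest one of the bottom cell. If a domino starts with a lower
  bottom entry, then this entry, a top entry before the middle, the middle and a higher top entry
  after it would form 1324; so the left top must lie above the right top. Avoiding 132 orders the
  bottom parts likewise.\<close>

locale branching =
  fixes na qa nb qb :: nat and f g :: "nat \<Rightarrow> nat"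
  assumes f: "f \<in> dominoes na qa" and g: "g \<in> dominoes nb qb" and qa: "qa \<le> na" and qb: "qb \<le> nb"
begin

abbreviation "E \<equiv> br na qa nb qb f g"
abbreviation "n \<equiv> na + nb + 1"
abbreviation "q \<equiv> qa + qb + 1"

lemma f_less: "i < na \<Longrightarrow> f i < na" and g_less: "na < i \<Longrightarrow> i < n \<Longrightarrow> g (i - na - 1) < nb"
  using permutes_less[OF dominoesD(1)[OF f]] permutes_less[OF dominoesD(1)[OF g]] by auto

lemma E_mid: "E na = qa + qb"
  by (simp add: br_def)

lemma E_left_less: "i < na \<Longrightarrow> j < na \<Longrightarrow> E i < E j \<longleftrightarrow> f i < f j"
  using qb by (auto simp: br_def)

lemma E_right_less:
  "na < i \<Longrightarrow> i < n \<Longrightarrow> na < j \<Longrightarrow> j < n \<Longrightarrow> E i < E j \<longleftrightarrow> g (i - na - 1) < g (j - na - 1)"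
  by (auto simp: br_def)

lemma E_left_bot: "i < na \<Longrightarrow> E i < q \<longleftrightarrow> f i < qa"
  using qb by (auto simp: br_def)

lemma E_right_bot: "na < i \<Longrightarrow> i < n \<Longrightarrow> E i < q \<longleftrightarrow> g (i - na - 1) < qb"
  by (auto simp: br_def)

lemma E_cross: "i < na \<Longrightarrow> na < j \<Longrightarrow> j < n \<Longrightarrow> E i < E j \<longleftrightarrow> E i < q \<and> q \<le> E j"
  using f_less[of i] g_less[of j] qa qb by (auto simp: br_def)

lemma E_less_mid: "i < n \<Longrightarrow> i \<noteq> na \<Longrightarrow> E i < E na \<longleftrightarrow> E i < q"
  using f_less[of i] g_less[of i] qa qb by (auto simp: br_def)

lemma E_mid_less: "i < n \<Longrightarrow> i \<noteq> na \<Longrightarrow> E na < E i \<longleftrightarrow> q \<le> E i"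
  using f_less[of i] g_less[of i] qa qb by (auto simp: br_def)

lemma E_mid_neq: "i < n \<Longrightarrow> i \<noteq> na \<Longrightarrow> E na \<noteq> E i"
  using E_less_mid E_mid_less by (metis linorder_not_less nless_le)

lemma E_cross_neq: "i < na \<Longrightarrow> na < j \<Longrightarrow> j < n \<Longrightarrow> E i \<noteq> E j"
  using f_less[of i] g_less[of j] qa qb by (auto simp: br_def)

lemma E_permutes: "E permutes {..<n}"
proof (rule permutesI_less)
  have *: "E i \<noteq> E j" if "i < j" "j < n" for i j
  proof -
    consider "j < na" | "na < i" | "i < na" "na < j" | "i = na" | "j = na" using \<open>i < j\<close> by linarith
    then show ?thesis
    proof cases
      case 1
      then have "f i \<noteq> f j" using that permutes_inj[OF dominoesD(1)[OF f]] by (auto dest: injD)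
      then show ?thesis using 1 that E_left_less[of i j] E_left_less[of j i] by auto
    next
      case 2
      then have "g (i - na - 1) \<noteq> g (j - na - 1)"
        using that inj_eq[OF permutes_inj[OF dominoesD(1)[OF g]]] by auto
      then show ?thesis using 2 that E_right_less[of i j] E_right_less[of j i] by auto
    next
      case 3
      then show ?thesis using E_cross_neq that by auto
    next
      case 4
      then show ?thesis using E_mid_neq[of j] that by auto
    next
      case 5
      then show ?thesis using E_mid_neq[of i] that by auto
    qed
  qed
  show "inj_on E {..<n}"
    by (rule linorder_inj_onI) (use * in \<open>auto simp del: add_Suc_right\<close>)
  show "E i < n" if "i < n" for i
    using that f_less[of i] g_less[of i] qa qb by (auto simp: br_def)
qed (simp add: br_def)

lemma E_top213: "top213 n q E"
  unfolding top213_def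
proof (intro allI impI notI)
  fix i j l assume *: "i < j" "j < l" "l < n" "q \<le> E j" "E j < E i \<and> E i < E l"
  have ne: "i \<noteq> na" "j \<noteq> na" "l \<noteq> na" using * E_mid by auto
  consider "l < na" | "na < i" | "i < na" "na < l" using ne by linarith
  then show False
  proof cases
    case 1
    then have "f j < f i" "f i < f l" "qa \<le> f j" using * E_left_less E_left_bot[of j] by auto
    then show False using dominoesD(3)[OF f] * 1 unfolding top213_def by blast
  next
    case 2
    then have "g (j - na - 1) < g (i - na - 1)" "g (i - na - 1) < g (l - na - 1)" "qb \<le> g (j - na - 1)"
      using * E_right_less E_right_bot[of j] by auto
    moreover have "i - na - 1 < j - na - 1" "j - na - 1 < l - na - 1" "l - na - 1 < nb"
      using * 2 by auto
    ultimately show False using dominoesD(3)[OF g] unfolding top213_def by blast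
  next
    case 3
    then show False using E_cross[of i l] * by auto
  qed
qed

lemma E_bot132: "bot132 n q E"
  unfolding bot132_def
proof (intro allI impI notI)
  fix i j l assume *: "i < j" "j < l" "l < n" "E j < q" "E i < E l \<and> E l < E j"
  have "i \<noteq> na" using * E_mid_less[of l] by auto
  moreover have "l \<noteq> na" using * E_mid_less[of j] by auto
  ultimately consider "l < na" | "na < i" | "i < na" "na < l" by linarith
  then show False
  proof cases
    case 1
    then have "f i < f l" "f l < f j" "f j < qa" using * E_left_less E_left_bot[of j] by auto
    then show False using dominoesD(4)[OF f] * 1 unfolding bot132_def by blast
  next
    case 2
    then have "g (i - na - 1) < g (l - na - 1)" "g (l - na - 1) < g (j - na - 1)" "g (j - na - 1) < qb"
      using * E_right_less E_right_bot[of j] by auto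
    moreover have "i - na - 1 < j - na - 1" "j - na - 1 < l - na - 1" "l - na - 1 < nb"
      using * 2 by auto
    ultimately show False using dominoesD(4)[OF g] unfolding bot132_def by blast
  next
    case 3
    then show False using E_cross[of i l] * by auto
  qed
qed

text \<open>A 2 in the top cell would give a top 213, a 3 in the bottom cell a bottom 132. So 1 and
  2 are bottom entries, 3 and 4 top entries. An ascent from the left part to the right part leads
  from bottom to top only, which keeps 1 with 2 and 3 with 4 on one side, and the positions then put
  all four into the same part.\<close>

lemma E_av1324: "av1324 n E"
  unfolding av1324_def
proof (intro allI impI notI)
  fix i j k l assume o: "i < j" "j < k" "k < l" "l < n"
    and p: "E i < E k \<and> E k < E j \<and> E j < E l"
  have no_low: "E k < q"
  proof (rule ccontr)
    assume "\<not> E k < q"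
    then show False using E_top213 o p unfolding top213_def by force
  qed
  have no_high: "q \<le> E j"
  proof (rule ccontr)
    assume "\<not> q \<le> E j"
    then show False using E_bot132 o p unfolding bot132_def by force
  qed
  have ne: "j \<noteq> na" "l \<noteq> na" "i \<noteq> na"
    using no_high E_mid p E_mid_less[of k] no_low o by auto
  have jl: "j < na \<longleftrightarrow> l < na" using E_cross[of j l] no_high p o ne by force
  show False
  proof (cases "l < na")
    case True
    then have "f i < f k" "f k < f j" "f j < f l" using o p E_left_less by auto
    then show False using av1324D[OF dominoesD(2)[OF f]] o True by blast
  next
    case False
    then have "na < j" using jl ne by simp
    show False
    proof (cases "na < i")
      case True
      then have "g (i - na - 1) < g (k - na - 1)" "g (k - na - 1) < g (j - na - 1)"
        "g (j - na - 1) < g (l - na - 1)" using o p E_right_less by auto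
      moreover have "i - na - 1 < j - na - 1" "j - na - 1 < k - na - 1" "k - na - 1 < l - na - 1"
        "l - na - 1 < nb"
        using o True by auto
      ultimately show False using av1324D[OF dominoesD(2)[OF g]] by blast
    next
      case False
      then show False using E_cross[of i k] p no_low o ne \<open>na < j\<close> by auto
    qed
  qed
qed

lemma E_domino: "E \<in> dominoes n q"
  using E_permutes E_av1324 E_top213 E_bot132 by (simp add: dominoes_def Av_def)

lemma slots_E:
  "slots n q E = (\<lambda>v. v + qa + 1) ` slots nb qb g \<union> (\<lambda>v. v + nb + 1) ` slots na qa f"
proof (intro equalityI subsetI)
  fix v assume v: "v \<in> slots n q E"
  then have no: "\<And>i j. i < j \<Longrightarrow> j < n \<Longrightarrow> q \<le> E i \<Longrightarrow> E i < v \<Longrightarrow> v \<le> E j \<Longrightarrow> False"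
    and qv: "q \<le> v" "v \<le> n"
    by (auto simp: slots_def)
  show "v \<in> (\<lambda>v. v + qa + 1) ` slots nb qb g \<union> (\<lambda>v. v + nb + 1) ` slots na qa f"
  proof (cases "v \<le> qa + nb + 1")
    case True
    have "v - qa - 1 \<in> slots nb qb g"
      unfolding slots_def
    proof (clarsimp, intro conjI allI impI)
      fix i j assume "i < j" "j < nb" "qb \<le> g i" "g i < v - Suc qa"
      then have "Suc (g i + qa) < v" by linarith
      moreover have "v \<le> Suc (g j + qa)" if "v - Suc qa \<le> g j" using that by linarith
      ultimately show "\<not> v - Suc qa \<le> g j"
        using no[of "i + na + 1" "j + na + 1"] \<open>i < j\<close> \<open>j < nb\<close> \<open>qb \<le> g i\<close>
          \<open>g i < v - Suc qa\<close> by (auto simp: br_def)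
    qed (use True qv in auto)
    moreover have "v = v - qa - 1 + qa + 1" using qv by simp
    ultimately show ?thesis by blast
  next
    case False
    have "v - nb - 1 \<in> slots na qa f"
      unfolding slots_def
    proof (clarsimp, intro conjI allI impI)
      fix i j assume "i < j" "j < na" "qa \<le> f i" "f i < v - Suc nb"
      then have "Suc (f i + nb) < v" by linarith
      moreover have "v \<le> Suc (f j + nb)" if "v - Suc nb \<le> f j" using that by linarith
      ultimately show "\<not> v - Suc nb \<le> f j"
        using no[of i j] qb \<open>i < j\<close> \<open>j < na\<close> \<open>qa \<le> f i\<close> by (auto simp: br_def)
    qed (use False qv in auto)
    moreover have "v = v - nb - 1 + nb + 1" using False by simp
    ultimately show ?thesis by blast
  qed
next
  fix v assume "v \<in> (\<lambda>v. v + qa + 1) ` slots nb qb g \<union> (\<lambda>v. v + nb + 1) ` slots na qa f"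
  then show "v \<in> slots n q E"
  proof
    assume "v \<in> (\<lambda>v. v + qa + 1) ` slots nb qb g"
    then obtain u where u: "v = u + qa + 1" "u \<in> slots nb qb g" by auto
    show ?thesis
      unfolding slots_def
    proof (intro CollectI conjI allI impI notI)
      fix i j assume *: "i < j" "j < n" "q \<le> E i" "E i < v \<and> v \<le> E j"
      have "na < i"
      proof (rule ccontr)
        assume "\<not> na < i"
        then show False using * u by (cases "i = na") (auto simp: br_def slots_def split: if_splits)
      qed
      have "qb \<le> g (i - na - 1)" using E_right_bot[of i] * \<open>na < i\<close> by auto
      moreover have "g (i - na - 1) < u" "u \<le> g (j - na - 1)"
        using * u \<open>na < i\<close> calculation by (auto simp: br_def slots_def split: if_splits)
      moreover have "i - na - 1 < j - na - 1" "j - na - 1 < nb" using * \<open>na < i\<close> by auto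
      ultimately show False using u(2) unfolding slots_def by blast
    qed (use u qa in \<open>auto simp: slots_def\<close>)
  next
    assume "v \<in> (\<lambda>v. v + nb + 1) ` slots na qa f"
    then obtain u where u: "v = u + nb + 1" "u \<in> slots na qa f" by auto
    show ?thesis
      unfolding slots_def
    proof (intro CollectI conjI allI impI notI)
      fix i j assume *: "i < j" "j < n" "q \<le> E i" "E i < v \<and> v \<le> E j"
      have "j < na"
      proof (rule ccontr)
        assume "\<not> j < na"
        then show False using * u g_less[of j] qb
          by (cases "j = na") (auto simp: br_def slots_def split: if_splits)
      qed
      then have "qa \<le> f i" using E_left_bot[of i] * by auto
      moreover have "f i < u" "u \<le> f j"
        using * u \<open>j < na\<close> calculation qb by (auto simp: br_def slots_def split: if_splits)
      ultimately show False using u(2) * \<open>j < na\<close> unfolding slots_def by blast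
    qed (use u qb in \<open>auto simp: slots_def\<close>)
  qed
qed

text \<open>The two ranges of slots meet in \<open>qa + nb + 1\<close>, the highest slot from
  \<open>g\<close> and the lowest from \<open>f\<close>. So the number of slots minus 1 is additive,
  which is why \<open>rts\<close> counts one less.\<close>

lemma card_slots_E: "card (slots n q E) + 1 = card (slots na qa f) + card (slots nb qb g)"
proof -
  let ?A = "(\<lambda>v. v + qa + 1) ` slots nb qb g" and ?B = "(\<lambda>v. v + nb + 1) ` slots na qa f"
  have "nb \<in> slots nb qb g"
    using qb permutes_less[OF dominoesD(1)[OF g]] by (fastforce simp: slots_def not_le)
  moreover have "qa \<in> slots na qa f" using qa by (auto simp: slots_def)
  ultimately have "?A \<inter> ?B = {qa + nb + 1}" by (auto simp: slots_def image_iff)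
  moreover have "card ?A = card (slots nb qb g)" "card ?B = card (slots na qa f)"
    by (intro card_image inj_onI; simp)+
  moreover have "card ?A + card ?B = card (?A \<union> ?B) + card (?A \<inter> ?B)"
    by (rule card_Un_Int) (simp_all add: finite_slots)
  ultimately show ?thesis unfolding slots_E by simp
qed

lemma card_left_bot: "card {i. i < na \<and> E i < q} = qa"
proof -
  have "{i. i < na \<and> E i < q} = inv f ` {..<qa}"
  proof (intro equalityI subsetI)
    fix i assume "i \<in> {i. i < na \<and> E i < q}"
    then have "f i < qa" using E_left_bot by auto
    then show "i \<in> inv f ` {..<qa}" using permutes_inverses(2)[OF dominoesD(1)[OF f]] by (metis imageI lessThan_iff)
  next
    fix i assume "i \<in> inv f ` {..<qa}"
    then obtain v where "v < qa" "i = inv f v" by auto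
    moreover from this have "i < na" "f i = v"
      using permutes_less[OF permutes_inv[OF dominoesD(1)[OF f]]] permutes_inverses(1)[OF dominoesD(1)[OF f]] qa
      by auto
    ultimately show "i \<in> {i. i < na \<and> E i < q}" using E_left_bot by auto
  qed
  moreover have "inj_on (inv f) {..<qa}"
    using permutes_inj[OF permutes_inv[OF dominoesD(1)[OF f]]] by (rule inj_on_subset) simp
  ultimately show ?thesis by (simp add: card_image)
qed

end

text \<open>The middle entry is recognised by its value, the highest in the bottom cell; its
  position gives \<open>na\<close>, and the number of bottom entries before it gives
  \<open>qa\<close>.\<close>

lemma br_inj:
  assumes A: "branching na qa nb qb f g" and B: "branching na' qa' nb' qb' f' g'"
    and n: "na + nb = na' + nb'" and q: "qa + qb = qa' + qb'"
    and eq: "br na qa nb qb f g = br na' qa' nb' qb' f' g'"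
  shows "na = na'" "qa = qa'" "nb = nb'" "qb = qb'" "f = f'" "g = g'"
proof -
  interpret A: branching na qa nb qb f g by fact
  interpret B: branching na' qa' nb' qb' f' g' by fact
  show na: "na = na'" 
    using A.E_mid B.E_mid q eq injD[OF permutes_inj[OF B.E_permutes], of na na'] by simp
  then show nb: "nb = nb'" using n by simp
  show qa: "qa = qa'" using A.card_left_bot B.card_left_bot eq na q by simp
  then show "qb = qb'" using q by simp
  show "f = f'"
    by (rule permutes_eqI[OF dominoesD(1)[OF A.f] dominoesD(1)[OF B.f, folded na]])
      (use A.E_left_less B.E_left_less eq na in simp)
  show "g = g'"
  proof (rule permutes_eqI[OF dominoesD(1)[OF A.g] dominoesD(1)[OF B.g, folded nb]])
    fix i j assume "i < nb" "j < nb"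
    then show "g i < g j \<longleftrightarrow> g' i < g' j"
      using A.E_right_less[of "i + na + 1" "j + na + 1"] B.E_right_less[of "i + na + 1" "j + na + 1"]
        eq na nb by simp
  qed
qed

section \<open>Adding a leftmost entry to the top cell\<close>

definition tp :: "nat \<Rightarrow> nat \<Rightarrow> (nat \<Rightarrow> nat) \<Rightarrow> nat \<Rightarrow> nat" where
  "tp n v e i =
    (if i = 0 then v else if i < n + 1 then (if e (i - 1) < v then e (i - 1) else e (i - 1) + 1) else i)"

locale topping =
  fixes n q v :: nat and e :: "nat \<Rightarrow> nat"
  assumes e: "e \<in> dominoes n q" and v: "v \<in> slots n q e"
begin

abbreviation "E \<equiv> tp n v e"

lemma qv: "q \<le> v" "v \<le> n"
  using v by (auto simp: slots_def)

lemma E_0: "E 0 = v"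
  by (simp add: tp_def)

lemma E_less_iff: "0 < i \<Longrightarrow> i < n + 1 \<Longrightarrow> 0 < j \<Longrightarrow> j < n + 1 \<Longrightarrow>
    E i < E j \<longleftrightarrow> e (i - 1) < e (j - 1)"
  by (auto simp: tp_def)

lemma E_less_0: "0 < i \<Longrightarrow> i < n + 1 \<Longrightarrow> E i < v \<longleftrightarrow> e (i - 1) < v"
  by (auto simp: tp_def)

lemma E_0_less: "0 < i \<Longrightarrow> i < n + 1 \<Longrightarrow> v < E i \<longleftrightarrow> v \<le> e (i - 1)"
  by (auto simp: tp_def)

lemma E_bot: "0 < i \<Longrightarrow> i < n + 1 \<Longrightarrow> E i < q \<longleftrightarrow> e (i - 1) < q"
  using qv by (auto simp: tp_def)

lemma E_permutes: "E permutes {..<n + 1}"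
proof (rule permutesI_less)
  have "E i \<noteq> E j" if "i < j" "j < n + 1" for i j
  proof (cases "i = 0")
    case True
    then show ?thesis using E_0 E_less_0[of j] E_0_less[of j] that by (cases "e (j - 1) < v") auto
  next
    case False
    then have "e (i - 1) \<noteq> e (j - 1)" using that inj_eq[OF permutes_inj[OF dominoesD(1)[OF e]]] by auto
    then show ?thesis using E_less_iff[of i j] E_less_iff[of j i] that False by auto
  qed
  then show "inj_on E {..<n + 1}" by (intro linorder_inj_onI) auto
  fix i assume "i < n + 1"
  then show "E i < n + 1"
    using qv permutes_less[OF dominoesD(1)[OF e], of "i - 1"] by (auto simp: tp_def)
qed (simp add: tp_def)

lemma E_top213: "top213 (n + 1) q E"
  unfolding top213_def
proof (intro allI impI notI)
  fix i j l assume *: "i < j" "j < l" "l < n + 1" "q \<le> E j" "E j < E i \<and> E i < E l"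
  have qj: "q \<le> e (j - 1)" using E_bot[of j] * by auto
  show False
  proof (cases "i = 0")
    case True
    then have "e (j - 1) < v" "v \<le> e (l - 1)" using * E_0 E_less_0[of j] E_0_less[of l] by auto
    moreover have "j - 1 < l - 1" "l - 1 < n" using * by auto
    ultimately show False using v qj unfolding slots_def by blast
  next
    case False
    then have "e (j - 1) < e (i - 1)" "e (i - 1) < e (l - 1)" using * E_less_iff by auto
    moreover have "i - 1 < j - 1" "j - 1 < l - 1" "l - 1 < n" using * False by auto
    ultimately show False using dominoesD(3)[OF e] qj unfolding top213_def by blast
  qed
qed

lemma E_bot132: "bot132 (n + 1) q E"
  unfolding bot132_def
proof (intro allI impI notI)
  fix i j l assume *: "i < j" "j < l" "l < n + 1" "E j < q" "E i < E l \<and> E l < E j"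
  then have "i \<noteq> 0" using E_0 qv by (auto intro: ccontr)
  then have "e (i - 1) < e (l - 1)" "e (l - 1) < e (j - 1)" "e (j - 1) < q"
    using * E_less_iff E_bot[of j] by auto
  moreover have "i - 1 < j - 1" "j - 1 < l - 1" "l - 1 < n" using * \<open>i \<noteq> 0\<close> by auto
  ultimately show False using dominoesD(4)[OF e] unfolding bot132_def by blast
qed

lemma E_av1324: "av1324 (n + 1) E"
  unfolding av1324_def
proof (intro allI impI notI)
  fix i j k l assume o: "i < j" "j < k" "k < l" "l < n + 1"
    and p: "E i < E k \<and> E k < E j \<and> E j < E l"
  show False
  proof (cases "i = 0")
    case True
    then have "q \<le> E k" using p E_0 qv by auto
    then show False using E_top213 o p unfolding top213_def by blast
  next
    case False
    then have "e (i - 1) < e (k - 1)" "e (k - 1) < e (j - 1)" "e (j - 1) < e (l - 1)"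
      using o p E_less_iff by auto
    moreover have "i - 1 < j - 1" "j - 1 < k - 1" "k - 1 < l - 1" "l - 1 < n" using o False by auto
    ultimately show False using av1324D[OF dominoesD(2)[OF e]] by blast
  qed
qed

lemma E_domino: "E \<in> dominoes (n + 1) q"
  using E_permutes E_av1324 E_top213 E_bot132 by (simp add: dominoes_def Av_def)

text \<open>The new first entry forms an ascent with every higher value, which spoils all slots
  above \<open>v\<close> but the topmost one.\<close>

lemma slots_E: "slots (n + 1) q E = insert (n + 1) {u \<in> slots n q e. u \<le> v}"
proof (intro equalityI subsetI)
  fix u assume "u \<in> slots (n + 1) q E"
  then have no: "\<And>i j. i < j \<Longrightarrow> j < n + 1 \<Longrightarrow> q \<le> E i \<Longrightarrow> E i < u \<Longrightarrow> u \<le> E j \<Longrightarrow> False"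
    and qu: "q \<le> u" "u \<le> n + 1"
    by (auto simp: slots_def)
  show "u \<in> insert (n + 1) {u \<in> slots n q e. u \<le> v}"
  proof (cases "u \<le> v")
    case True
    have "u \<in> slots n q e"
      unfolding slots_def
    proof (intro CollectI conjI allI impI notI)
      fix i j assume "i < j" "j < n" "q \<le> e i" "e i < u \<and> u \<le> e j"
      moreover from this have "E (i + 1) = e i" "u \<le> E (j + 1)"
        using True by (simp_all add: tp_def)
      ultimately show False using no[of "i + 1" "j + 1"] by simp
    qed (use True qu qv in auto)
    then show ?thesis using True by simp
  next
    case False
    have "u = n + 1"
    proof (rule ccontr)
      assume "u \<noteq> n + 1"
      define j where "j = inv E n"
      have j: "j < n + 1" "E j = n"
        using permutes_less[OF permutes_inv[OF E_permutes], of n] permutes_inverses(1)[OF E_permutes]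
        by (auto simp: j_def)
      then have "j \<noteq> 0" using E_0 False qu \<open>u \<noteq> n + 1\<close> by (auto intro: ccontr)
      then show False using no[of 0 j] E_0 qv False j qu \<open>u \<noteq> n + 1\<close> by auto
    qed
    then show ?thesis by simp
  qed
next
  fix u assume u: "u \<in> insert (n + 1) {u \<in> slots n q e. u \<le> v}"
  show "u \<in> slots (n + 1) q E"
  proof (cases "u = n + 1")
    case True
    have "E j < n + 1" if "j < n + 1" for j using permutes_less[OF E_permutes] that by simp
    then show ?thesis using True qv by (fastforce simp: slots_def)
  next
    case False
    then have u: "u \<in> slots n q e" "u \<le> v" using u by auto
    show ?thesis
      unfolding slots_def
    proof (intro CollectI conjI allI impI notI)
      fix i j assume *: "i < j" "j < n + 1" "q \<le> E i" "E i < u \<and> u \<le> E j"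
      then have "i \<noteq> 0" using E_0 u by (auto intro: ccontr)
      then have "q \<le> e (i - 1)" using E_bot[of i] * by auto
      moreover have "e (i - 1) < u" "u \<le> e (j - 1)"
        using * u \<open>i \<noteq> 0\<close> by (auto simp: tp_def split: if_splits)
      moreover have "i - 1 < j - 1" "j - 1 < n" using * \<open>i \<noteq> 0\<close> by auto
      ultimately show False using u(1) unfolding slots_def by blast
    qed (use u in \<open>auto simp: slots_def\<close>)
  qed
qed

end

lemma tp_inj:
  assumes A: "topping n q v e" and B: "topping n q' v' e'" and eq: "tp n v e = tp n v' e'"
  shows "v = v'" "e = e'"
proof -
  interpret A: topping n q v e by fact
  interpret B: topping n q' v' e' by fact
  show "v = v'" using A.E_0 B.E_0 eq by simp
  show "e = e'"
  proof (rule permutes_eqI[OF dominoesD(1)[OF A.e] dominoesD(1)[OF B.e]])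
    fix i j assume "i < n" "j < n"
    then show "e i < e j \<longleftrightarrow> e' i < e' j"
      using A.E_less_iff[of "i + 1" "j + 1"] B.E_less_iff[of "i + 1" "j + 1"] eq by simp
  qed
qed

section \<open>Trees encoding dominoes\<close>

text \<open>\<open>Br\<close> stands for \<^const>\<open>br\<close>, and \<open>Tp j\<close> for the insertion of a leftmost top entry at the \<open>j\<close>-th smallest
  slot, counted from 0. There are \<open>rts t + 1\<close> slots. The first argument of \<open>Br\<close> must not be a \<open>Tp\<close>: then the first entry
  of a \<open>Br\<close> belongs to the bottom cell, which separates the two constructors.\<close>

datatype dtree = Leaf | Br dtree dtree | Tp nat dtree

primrec sz :: "dtree \<Rightarrow> nat" where
  "sz Leaf = 0"
| "sz (Br t u) = sz t + sz u + 1"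
| "sz (Tp j t) = sz t + 1"

primrec bots :: "dtree \<Rightarrow> nat" where
  "bots Leaf = 0"
| "bots (Br t u) = bots t + bots u + 1"
| "bots (Tp j t) = bots t"

primrec rts :: "dtree \<Rightarrow> nat" where
  "rts Leaf = 0"
| "rts (Br t u) = rts t + rts u"
| "rts (Tp j t) = j + 1"

primrec is_Tp :: "dtree \<Rightarrow> bool" where
  "is_Tp Leaf \<longleftrightarrow> False"
| "is_Tp (Br t u) \<longleftrightarrow> False"
| "is_Tp (Tp j t) \<longleftrightarrow> True"

primrec wf_dtree :: "dtree \<Rightarrow> bool" where
  "wf_dtree Leaf \<longleftrightarrow> True"
| "wf_dtree (Br t u) \<longleftrightarrow> \<not> is_Tp t \<and> wf_dtree t \<and> wf_dtree u"
| "wf_dtree (Tp j t) \<longleftrightarrow> wf_dtree t \<and> j \<le> rts t"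

primrec perm :: "dtree \<Rightarrow> nat \<Rightarrow> nat" where
  "perm Leaf = (\<lambda>i. i)"
| "perm (Br t u) = br (sz t) (bots t) (sz u) (bots u) (perm t) (perm u)"
| "perm (Tp j t) = tp (sz t) (sorted_list_of_set (slots (sz t) (bots t) (perm t)) ! j) (perm t)"

lemma card_le_nth_sorted_list:
  fixes S :: "nat set"
  assumes "finite S" "j < card S"
  shows "card {u \<in> S. u \<le> sorted_list_of_set S ! j} = j + 1"
proof -
  let ?l = "sorted_list_of_set S"
  have less: "?l ! a < ?l ! b" if "a < b" "b < card S" for a b
    using sorted_wrt_nth_less[OF strict_sorted_list_of_set[of S], of a b] that by simp
  have "{u \<in> S. u \<le> ?l ! j} = (\<lambda>i. ?l ! i) ` {..j}"
  proof (intro equalityI subsetI)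
    fix u assume u: "u \<in> {u \<in> S. u \<le> ?l ! j}"
    then have "u \<in> set ?l" using assms by simp
    then obtain i where i: "i < card S" "u = ?l ! i"
      by (metis in_set_conv_nth length_sorted_list_of_set)
    then have "i \<le> j" using less[of j i] u by (auto simp: not_le[symmetric])
    then show "u \<in> (\<lambda>i. ?l ! i) ` {..j}" using i by auto
  next
    fix u assume "u \<in> (\<lambda>i. ?l ! i) ` {..j}"
    then obtain i where i: "i \<le> j" "u = ?l ! i" by auto
    then have "?l ! i \<le> ?l ! j" using less[of i j] assms by (cases "i = j") auto
    moreover have "?l ! i \<in> set ?l" using i assms by (intro nth_mem) simp
    ultimately show "u \<in> {u \<in> S. u \<le> ?l ! j}" using assms i by simp
  qed
  moreover have "inj_on (\<lambda>i. ?l ! i) {..j}"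
    by (rule linorder_inj_onI) (use less assms in \<open>force+\<close>)
  ultimately show ?thesis by (simp add: card_image)
qed

lemma perm_domino:
  "wf_dtree t \<Longrightarrow> perm t \<in> dominoes (sz t) (bots t) \<and> bots t \<le> sz t \<and>
    card (slots (sz t) (bots t) (perm t)) = rts t + 1 \<and>
    (\<not> is_Tp t \<longrightarrow> 0 < sz t \<longrightarrow> perm t 0 < bots t)"
proof (induction t)
  case Leaf
  have "slots 0 0 (\<lambda>i. i) = {0}" by (auto simp: slots_def)
  then show ?case
    using id_in_Av[of 0] by (simp add: id_def dominoes_def top213_def bot132_def)
next
  case (Br t u)
  have t: "perm t \<in> dominoes (sz t) (bots t)" "bots t \<le> sz t"
    "card (slots (sz t) (bots t) (perm t)) = rts t + 1" "0 < sz t \<Longrightarrow> perm t 0 < bots t"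
    and u: "perm u \<in> dominoes (sz u) (bots u)" "bots u \<le> sz u"
    "card (slots (sz u) (bots u) (perm u)) = rts u + 1"
    using Br by simp_all
  interpret branching "sz t" "bots t" "sz u" "bots u" "perm t" "perm u"
    by (rule branching.intro[OF t(1) u(1) t(2) u(2)])
  have "E 0 < q"
  proof (cases "sz t = 0")
    case True
    then show ?thesis using E_mid by simp
  next
    case False
    then show ?thesis using E_left_bot[of 0] t(4) by simp
  qed
  then show ?case using E_domino card_slots_E t u by simp
next
  case (Tp j t)
  let ?S = "slots (sz t) (bots t) (perm t)"
  let ?v = "sorted_list_of_set ?S ! j"
  have t: "perm t \<in> dominoes (sz t) (bots t)" "bots t \<le> sz t" "card ?S = rts t + 1"
    using Tp by simp_all
  have j: "j < card ?S" using Tp.prems t by simp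
  then have "?v \<in> set (sorted_list_of_set ?S)" by (intro nth_mem) simp
  then have "?v \<in> ?S" using finite_slots by simp
  then interpret topping "sz t" "bots t" ?v "perm t"
    by (rule topping.intro[OF t(1)])
  have "card (slots (sz t + 1) (bots t) E) = card (insert (sz t + 1) {u \<in> ?S. u \<le> ?v})"
    unfolding slots_E ..
  also have "\<dots> = j + 2"
    using card_le_nth_sorted_list[OF finite_slots j] finite_slots[of "sz t" "bots t" "perm t"]
    by (subst card_insert_disjoint) (auto simp: slots_def)
  finally show ?case using E_domino t by simp
qed

lemma branchingI: "wf_dtree (Br t u) \<Longrightarrow> branching (sz t) (bots t) (sz u) (bots u) (perm t) (perm u)"
  using perm_domino[of t] perm_domino[of u] by (simp add: branching.intro)

lemma slot_mem:
  "wf_dtree (Tp j t) \<Longrightarrow>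
    sorted_list_of_set (slots (sz t) (bots t) (perm t)) ! j \<in> slots (sz t) (bots t) (perm t)"
  using perm_domino[of t] nth_mem[of j "sorted_list_of_set (slots (sz t) (bots t) (perm t))"]
    finite_slots[of "sz t" "bots t" "perm t"] by simp

lemma toppingI:
  assumes "wf_dtree (Tp j t)"
  shows "topping (sz t) (bots t) (sorted_list_of_set (slots (sz t) (bots t) (perm t)) ! j) (perm t)"
  using perm_domino[of t] slot_mem[OF assms] assms by (simp add: topping.intro)

lemma perm_inj:
  "wf_dtree t \<Longrightarrow> wf_dtree u \<Longrightarrow> sz t = sz u \<Longrightarrow> bots t = bots u \<Longrightarrow> perm t = perm u \<Longrightarrow> t = u"
proof (induction t arbitrary: u)
  case Leaf
  then show ?case by (cases u) auto
next
  case (Br t1 t2)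
  have first: "perm (Br t1 t2) 0 < bots (Br t1 t2)"
    using perm_domino[OF Br.prems(1)] by simp
  show ?case
  proof (cases u)
    case (Br u1 u2)
    have B: "branching (sz t1) (bots t1) (sz t2) (bots t2) (perm t1) (perm t2)"
      "branching (sz u1) (bots u1) (sz u2) (bots u2) (perm u1) (perm u2)"
      using Br.prems Br branchingI by blast+
    have "sz t1 + sz t2 = sz u1 + sz u2" "bots t1 + bots t2 = bots u1 + bots u2"
      "br (sz t1) (bots t1) (sz t2) (bots t2) (perm t1) (perm t2) =
       br (sz u1) (bots u1) (sz u2) (bots u2) (perm u1) (perm u2)"
      using Br.prems Br by simp_all
    from br_inj[OF B this] have "t1 = u1" "t2 = u2" using Br.IH Br.prems Br by auto
    then show ?thesis using Br by simp
  next
    case (Tp j u')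
    have "perm u 0 \<ge> bots u"
      using topping.qv(1)[OF toppingI] topping.E_0[OF toppingI] Br.prems Tp by auto
    then show ?thesis using first Br.prems by simp
  qed (use Br.prems in simp)
next
  case (Tp j t)
  have T: "topping (sz t) (bots t) (sorted_list_of_set (slots (sz t) (bots t) (perm t)) ! j) (perm t)"
    by (rule toppingI[OF Tp.prems(1)])
  show ?case
  proof (cases u)
    case (Tp k u')
    let ?l = "\<lambda>t. sorted_list_of_set (slots (sz t) (bots t) (perm t))"
    have s: "sz u' = sz t" using Tp.prems Tp by simp
    have U: "topping (sz t) (bots u') (?l u' ! k) (perm u')"
      using toppingI[of k u'] Tp.prems Tp by (simp add: s)
    have eq: "tp (sz t) (?l t ! j) (perm t) = tp (sz t) (?l u' ! k) (perm u')"
      using Tp.prems Tp by (simp add: s)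
    have "perm t = perm u'" "?l t ! j = ?l u' ! k" using tp_inj[OF T U eq] by simp_all
    moreover from this have tu: "t = u'" using Tp.IH Tp.prems Tp by simp
    moreover have "j < length (?l t)" "k < length (?l t)"
      using perm_domino[of t] Tp.prems Tp tu by simp_all
    ultimately have "j = k" by (simp add: nth_eq_iff_index_eq)
    then show ?thesis using tu Tp by simp
  next
    case (Br u1 u2)
    have "perm u 0 < bots u" using perm_domino[of u] Tp.prems Br by simp
    moreover have "perm (Tp j t) 0 \<ge> bots (Tp j t)"
      using topping.qv(1)[OF T] topping.E_0[OF T] by simp
    ultimately show ?thesis using Tp.prems by simp
  qed (use Tp.prems in simp)
qed

definition dtrees :: "nat \<Rightarrow> dtree set" where
  "dtrees n = {t. wf_dtree t \<and> sz t = n}"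

lemma finite_dtrees: "finite (dtrees n)"
  and card_dtrees: "card (dtrees n) \<le> (\<Sum>q\<le>n. card (dominoes n q))"
proof -
  have inj: "inj_on (\<lambda>t. (bots t, perm t)) (dtrees n)"
    by (rule inj_onI) (auto simp: dtrees_def intro: perm_inj)
  have sub: "(\<lambda>t. (bots t, perm t)) ` dtrees n \<subseteq> (SIGMA q:{..n}. dominoes n q)"
    using perm_domino by (auto simp: dtrees_def)
  have fin: "finite (SIGMA q:{..n}. dominoes n q)" using finite_dominoes by auto
  show "finite (dtrees n)" by (rule inj_on_finite[OF inj sub fin])
  show "card (dtrees n) \<le> (\<Sum>q\<le>n. card (dominoes n q))"
    using card_inj_on_le[OF inj sub fin] finite_dominoes by (simp add: card_SigmaI)
qed

section \<open>The generating function of the trees\<close>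

text \<open>The variable \<open>v\<close> is the catalytic one: it records the slots, normalised so
  that \<open>Br\<close> becomes a product.\<close>

definition tree_poly :: "nat \<Rightarrow> real \<Rightarrow> real" where
  "tree_poly n v = (\<Sum>t\<in>dtrees n. v ^ rts t)"

definition br_poly :: "nat \<Rightarrow> real \<Rightarrow> real" where
  "br_poly n v = (\<Sum>t\<in>{t \<in> dtrees n. \<not> is_Tp t}. v ^ rts t)"

lemma dtrees_0: "dtrees 0 = {Leaf}"
proof -
  have "t \<in> dtrees 0 \<longleftrightarrow> t = Leaf" for t by (cases t) (auto simp: dtrees_def)
  then show ?thesis by blast
qed

lemma tree_poly_0: "tree_poly 0 v = 1" and br_poly_0: "br_poly 0 v = 1"
proof -
  show "tree_poly 0 v = 1" by (simp add: tree_poly_def dtrees_0)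
  have "{t \<in> dtrees 0. \<not> is_Tp t} = {Leaf}" by (auto simp: dtrees_0)
  then show "br_poly 0 v = 1" by (simp add: br_poly_def)
qed

lemma br_poly_Suc: "br_poly (Suc n) v = (\<Sum>i\<le>n. br_poly i v * tree_poly (n - i) v)"
proof -
  let ?N = "\<lambda>i. {t \<in> dtrees i. \<not> is_Tp t}"
  let ?D = "SIGMA i:{..n}. ?N i \<times> dtrees (n - i)"
  have "bij_betw (\<lambda>(i, t, u). Br t u) ?D (?N (Suc n))"
    unfolding bij_betw_def
  proof
    show "inj_on (\<lambda>(i, t, u). Br t u) ?D" by (rule inj_onI) (auto simp: dtrees_def)
    have "x \<in> (\<lambda>(i, t, u). Br t u) ` ?D" if "x \<in> ?N (Suc n)" for x
      using that
    proof (cases x)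
      case (Br t u)
      then have "(sz t, t, u) \<in> ?D" using that by (auto simp: dtrees_def)
      then show ?thesis using Br by force
    qed (auto simp: dtrees_def)
    then show "(\<lambda>(i, t, u). Br t u) ` ?D = ?N (Suc n)" by (auto simp: dtrees_def)
  qed
  then have "br_poly (Suc n) v = (\<Sum>(i, t, u)\<in>?D. v ^ rts (Br t u))"
    unfolding br_poly_def by (subst sum.reindex_bij_betw[symmetric]) (auto simp: case_prod_unfold)
  also have "\<dots> = (\<Sum>i\<le>n. \<Sum>(t, u)\<in>?N i \<times> dtrees (n - i). v ^ rts t * v ^ rts u)"
    by (subst sum.Sigma) (auto simp: finite_dtrees power_add case_prod_unfold)
  also have "\<dots> = (\<Sum>i\<le>n. br_poly i v * tree_poly (n - i) v)"
    unfolding br_poly_def tree_poly_def by (simp add: sum_product sum.cartesian_product)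
  finally show ?thesis .
qed

text \<open>Adding a \<open>Tp\<close> turns \<open>v ^ r\<close> into the sum of the powers from
  \<open>v\<close> to \<open>v ^ (r + 1)\<close>. The geometric sum is kept multiplied by
  \<open>v - 1\<close>, so that nothing is divided by 0 at \<open>v = 1\<close>.\<close>

lemma tree_poly_Suc: "(v - 1) * (tree_poly (Suc n) v - br_poly (Suc n) v) = v * (v * tree_poly n v - tree_poly n 1)"
proof -
  let ?T = "{t \<in> dtrees (Suc n). is_Tp t}"
  let ?D = "SIGMA t:dtrees n. {..rts t}"
  have "bij_betw (\<lambda>(t, j). Tp j t) ?D ?T"
    unfolding bij_betw_def
  proof
    show "inj_on (\<lambda>(t, j). Tp j t) ?D" by (rule inj_onI) auto
    have "x \<in> (\<lambda>(t, j). Tp j t) ` ?D" if "x \<in> ?T" for x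
      using that
    proof (cases x)
      case (Tp j t)
      then have "(t, j) \<in> ?D" using that by (auto simp: dtrees_def)
      then show ?thesis using Tp by force
    qed (auto simp: dtrees_def)
    then show "(\<lambda>(t, j). Tp j t) ` ?D = ?T" by (auto simp: dtrees_def)
  qed
  then have "(\<Sum>t\<in>?T. v ^ rts t) = (\<Sum>(t, j)\<in>?D. v ^ rts (Tp j t))"
    by (subst sum.reindex_bij_betw[symmetric]) (auto simp: case_prod_unfold)
  also have "\<dots> = (\<Sum>t\<in>dtrees n. \<Sum>j\<le>rts t. v ^ (j + 1))"
    by (subst sum.Sigma) (auto simp: finite_dtrees)
  finally have T: "(\<Sum>t\<in>?T. v ^ rts t) = (\<Sum>t\<in>dtrees n. \<Sum>j\<le>rts t. v ^ (j + 1))" .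
  have "dtrees (Suc n) = ?T \<union> {t \<in> dtrees (Suc n). \<not> is_Tp t}" by auto
  then have "tree_poly (Suc n) v = (\<Sum>t\<in>?T \<union> {t \<in> dtrees (Suc n). \<not> is_Tp t}. v ^ rts t)"
    unfolding tree_poly_def by simp
  also have "\<dots> = (\<Sum>t\<in>?T. v ^ rts t) + br_poly (Suc n) v"
    unfolding br_poly_def by (rule sum.union_disjoint) (auto simp: finite_dtrees)
  finally have "(v - 1) * (tree_poly (Suc n) v - br_poly (Suc n) v)
      = (\<Sum>t\<in>dtrees n. (v - 1) * (\<Sum>j\<le>rts t. v ^ (j + 1)))"
    unfolding T by (simp add: sum_distrib_left)
  also have "\<dots> = (\<Sum>t\<in>dtrees n. v * (v * v ^ rts t - 1))"
  proof (rule sum.cong)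
    fix t
    have "(v - 1) * (\<Sum>j\<le>rts t. v ^ (j + 1)) = v * ((v - 1) * (\<Sum>j\<le>rts t. v ^ j))"
      by (simp add: sum_distrib_left mult.left_commute)
    also have "(v - 1) * (\<Sum>j\<le>rts t. v ^ j) = v ^ Suc (rts t) - 1"
      using power_diff_1_eq[of v "Suc (rts t)"] by (simp add: lessThan_Suc_atMost)
    finally show "(v - 1) * (\<Sum>j\<le>rts t. v ^ (j + 1)) = v * (v * v ^ rts t - 1)" by simp
  qed simp
  also have "\<dots> = v * (v * tree_poly n v - tree_poly n 1)"
    unfolding tree_poly_def by (simp add: sum_distrib_left sum_subtractf right_diff_distrib)
  finally show ?thesis .
qed

lemma tree_poly_1: "tree_poly n 1 = card (dtrees n)"
  by (simp add: tree_poly_def)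

lemma tree_poly_nonneg: "v \<ge> 0 \<Longrightarrow> tree_poly n v \<ge> 0" and br_poly_nonneg: "v \<ge> 0 \<Longrightarrow> br_poly n v \<ge> 0"
  by (auto simp: tree_poly_def br_poly_def intro: sum_nonneg)

lemma br_poly_le_tree_poly: "v \<ge> 0 \<Longrightarrow> br_poly n v \<le> tree_poly n v"
  unfolding tree_poly_def br_poly_def by (rule sum_mono2) (auto simp: finite_dtrees)

lemma rts_le_sz: "wf_dtree t \<Longrightarrow> rts t \<le> sz t"
  by (induction t) auto

lemma card_dtrees_le: "card (dtrees n) \<le> 32 ^ n"
proof -
  have "card (dtrees n) \<le> (\<Sum>q\<le>n. card (dominoes n q))" by (rule card_dtrees)
  also have "\<dots> \<le> (\<Sum>q\<le>n. 16 ^ n)"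
  proof (rule sum_mono)
    fix q
    have "card (dominoes n q) \<le> card (Av n)" by (rule card_mono[OF finite_Av]) (auto simp: dominoes_def)
    also have "\<dots> \<le> 16 ^ n" by (rule card_Av_le)
    finally show "card (dominoes n q) \<le> 16 ^ n" .
  qed
  also have "\<dots> = Suc n * 16 ^ n" by simp
  also have "\<dots> \<le> 2 ^ n * 16 ^ n" by (rule mult_right_mono[OF Suc_leI[OF less_exp]]) simp
  also have "\<dots> = 32 ^ n" by (simp flip: power_mult_distrib)
  finally show ?thesis .
qed

lemma tree_poly_le:
  assumes "0 \<le> v" "v \<le> 2"
  shows "tree_poly n v \<le> 64 ^ n"
proof -
  have "tree_poly n v \<le> (\<Sum>t\<in>dtrees n. 2 ^ n)"
    unfolding tree_poly_def
  proof (rule sum_mono)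
    fix t assume t: "t \<in> dtrees n"
    have "v ^ rts t \<le> 2 ^ rts t" using assms by (intro power_mono)
    also have "\<dots> \<le> 2 ^ n" using t rts_le_sz[of t] by (intro power_increasing) (auto simp: dtrees_def)
    finally show "v ^ rts t \<le> 2 ^ n" .
  qed
  also have "\<dots> = real (card (dtrees n)) * 2 ^ n" by simp
  also have "\<dots> \<le> real (32 ^ n) * 2 ^ n"
    using card_dtrees_le[of n] by (intro mult_right_mono) (simp_all only: of_nat_le_iff zero_le_power zero_le_numeral)
  also have "\<dots> = 64 ^ n" by (simp flip: power_mult_distrib)
  finally show ?thesis .
qed

section \<open>Functional equation and parametrization for small arguments\<close>

definition tree_gf :: "real \<Rightarrow> real \<Rightarrow> real" where
  "tree_gf z v = (\<Sum>n. tree_poly n v * z ^ n)"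

text \<open>The limit 1/128 turns the crude bound \<open>64 ^ n\<close> for the coefficients into a
  geometric majorant of sum 2, uniform in \<open>v\<close>.\<close>

lemma tree_poly_term_le:
  assumes "0 \<le> v" "v \<le> 2" "0 \<le> z" "z \<le> 1 / 128"
  shows "norm (tree_poly n v * z ^ n) \<le> (1 / 2) ^ n"
proof -
  have "tree_poly n v * z ^ n \<le> 64 ^ n * (1 / 128) ^ n"
    using assms tree_poly_le tree_poly_nonneg by (intro mult_mono power_mono) auto
  also have "\<dots> = (1 / 2) ^ n" by (simp flip: power_mult_distrib)
  finally show ?thesis using assms tree_poly_nonneg by simp
qed

lemma summable_tree_poly:
  assumes "0 \<le> v" "v \<le> 2" "0 \<le> z" "z \<le> 1 / 128"
  shows "summable (\<lambda>n. norm (tree_poly n v * z ^ n))" "summable (\<lambda>n. tree_poly n v * z ^ n)"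
proof -
  show *: "summable (\<lambda>n. norm (tree_poly n v * z ^ n))"
    by (rule summable_comparison_test'[of "\<lambda>n. (1 / 2) ^ n" 0])
      (use tree_poly_term_le[OF assms] in \<open>auto intro: summable_geometric\<close>)
  then show "summable (\<lambda>n. tree_poly n v * z ^ n)" by (rule summable_norm_cancel)
qed

lemma tree_gf_le_2:
  assumes "0 \<le> v" "v \<le> 2" "0 \<le> z" "z \<le> 1 / 128"
  shows "tree_gf z v \<le> 2"
proof -
  have "tree_gf z v \<le> (\<Sum>n. (1 / 2) ^ n)"
    unfolding tree_gf_def
    by (rule suminf_le[OF _ summable_tree_poly(2)[OF assms] summable_geometric])
      (use tree_poly_term_le[OF assms] in \<open>auto intro: order_trans[OF abs_ge_self]\<close>)
  then show ?thesis using suminf_geometric[of "1 / 2 :: real"] by simp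
qed

lemma tree_gf_ge_1:
  assumes "0 \<le> v" "v \<le> 2" "0 \<le> z" "z \<le> 1 / 128"
  shows "1 \<le> tree_gf z v"
proof -
  have "sum (\<lambda>n. tree_poly n v * z ^ n) {..<1} \<le> tree_gf z v"
    unfolding tree_gf_def by (rule sum_le_suminf[OF summable_tree_poly(2)[OF assms]]) (use assms tree_poly_nonneg in auto)
  then show ?thesis by (simp add: tree_poly_0)
qed

text \<open>Let F and H be the series of all trees and of those without \<open>Tp\<close> at the
  root. Then \<open>H * (1 - z * F) = 1\<close> from \<open>Br\<close>, and
  \<open>(v - 1) * (F - H) = z * v * (v * F - F(1))\<close> from \<open>Tp\<close>; eliminating H
  gives the equation.\<close>

lemma tree_gf_functional:
  assumes "0 \<le> v" "v \<le> 2" "0 \<le> z" "z \<le> 1 / 128"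
  shows "((v - 1 - z * v\<^sup>2) * tree_gf z v + z * v * tree_gf z 1) * (1 - z * tree_gf z v) = v - 1"
proof -
  note sP = summable_tree_poly[OF assms]
  have s1: "summable (\<lambda>n. tree_poly n 1 * z ^ n)" using summable_tree_poly(2)[of 1 z] assms by simp
  define H where "H = (\<Sum>n. br_poly n v * z ^ n)"
  have sG: "summable (\<lambda>n. norm (br_poly n v * z ^ n))"
    by (rule summable_comparison_test'[OF sP(2), of 0])
      (use assms br_poly_nonneg br_poly_le_tree_poly in \<open>auto intro: mult_right_mono\<close>)
  then have sG': "summable (\<lambda>n. br_poly n v * z ^ n)" by (rule summable_norm_cancel)
  have "H * tree_gf z v = (\<Sum>n. \<Sum>i\<le>n. (br_poly i v * z ^ i) * (tree_poly (n - i) v * z ^ (n - i)))"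
    unfolding H_def tree_gf_def by (rule Cauchy_product[OF sG sP(1)])
  also have "(\<lambda>n. \<Sum>i\<le>n. (br_poly i v * z ^ i) * (tree_poly (n - i) v * z ^ (n - i))) = (\<lambda>n. br_poly (Suc n) v * z ^ n)"
  proof
    fix n
    have "z ^ i * z ^ (n - i) = z ^ n" if "i \<le> n" for i
      using that by (simp flip: power_add)
    then show "(\<Sum>i\<le>n. (br_poly i v * z ^ i) * (tree_poly (n - i) v * z ^ (n - i))) = br_poly (Suc n) v * z ^ n"
      unfolding br_poly_Suc sum_distrib_right by (intro sum.cong) (auto simp: algebra_simps)
  qed
  finally have "z * (H * tree_gf z v) = (\<Sum>n. z * (br_poly (Suc n) v * z ^ n))"
    using sG' summable_Suc_iff[of "\<lambda>n. br_poly n v * z ^ n"]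
    by (cases "z = 0") (auto simp: suminf_mult mult.left_commute[of _ z] summable_cmult_iff)
  also have "\<dots> = H - 1"
    using suminf_split_head[OF sG'] by (simp add: H_def br_poly_0 mult.left_commute)
  finally have H: "H * (1 - z * tree_gf z v) = 1" by (simp add: algebra_simps)
  have sPS: "summable (\<lambda>n. tree_poly (Suc n) v * z ^ Suc n)" "summable (\<lambda>n. br_poly (Suc n) v * z ^ Suc n)"
    using sP(2) sG' summable_Suc_iff[of "\<lambda>n. tree_poly n v * z ^ n"] summable_Suc_iff[of "\<lambda>n. br_poly n v * z ^ n"]
    by simp_all
  have "tree_gf z v - H = (\<Sum>n. tree_poly (Suc n) v * z ^ Suc n) - (\<Sum>n. br_poly (Suc n) v * z ^ Suc n)"
    using suminf_split_head[OF sG'] suminf_split_head[OF sP(2)] by (simp add: H_def tree_gf_def br_poly_0 tree_poly_0)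
  also have "\<dots> = (\<Sum>n. tree_poly (Suc n) v * z ^ Suc n - br_poly (Suc n) v * z ^ Suc n)"
    by (rule suminf_diff[OF sPS])
  finally have "(v - 1) * (tree_gf z v - H) = (\<Sum>n. (v - 1) * (tree_poly (Suc n) v * z ^ Suc n - br_poly (Suc n) v * z ^ Suc n))"
    using suminf_mult[OF summable_diff[OF sPS]] by simp
  also have "(\<lambda>n. (v - 1) * (tree_poly (Suc n) v * z ^ Suc n - br_poly (Suc n) v * z ^ Suc n))
      = (\<lambda>n. z * v * (v * (tree_poly n v * z ^ n) - tree_poly n 1 * z ^ n))"
  proof
    fix n
    have "(v - 1) * (tree_poly (Suc n) v * z ^ Suc n - br_poly (Suc n) v * z ^ Suc n)
        = ((v - 1) * (tree_poly (Suc n) v - br_poly (Suc n) v)) * z ^ Suc n"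
      by (simp add: algebra_simps)
    also have "\<dots> = z * v * (v * (tree_poly n v * z ^ n) - tree_poly n 1 * z ^ n)"
      unfolding tree_poly_Suc by (simp add: algebra_simps)
    finally show "(v - 1) * (tree_poly (Suc n) v * z ^ Suc n - br_poly (Suc n) v * z ^ Suc n)
      = z * v * (v * (tree_poly n v * z ^ n) - tree_poly n 1 * z ^ n)" .
  qed
  also have "(\<Sum>n. z * v * (v * (tree_poly n v * z ^ n) - tree_poly n 1 * z ^ n)) = z * v * (v * tree_gf z v - tree_gf z 1)"
    unfolding tree_gf_def
    by (intro sums_unique[symmetric] sums_mult sums_diff summable_sums sP(2) s1)
  finally have "(v - 1) * (tree_gf z v - H) = z * v * (v * tree_gf z v - tree_gf z 1)" .
  then have "(v - 1 - z * v\<^sup>2) * tree_gf z v + z * v * tree_gf z 1 = (v - 1) * H"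
    by (simp add: algebra_simps power2_eq_square)
  then show ?thesis using H by (simp add: mult.assoc)
qed

lemma continuous_on_tree_gf:
  assumes "0 \<le> z" "z \<le> 1 / 128"
  shows "continuous_on {1..2} (tree_gf z)"
proof -
  have "uniform_limit {1..2} (\<lambda>n v. \<Sum>i<n. tree_poly i v * z ^ i) (\<lambda>v. \<Sum>i. tree_poly i v * z ^ i) sequentially"
    by (rule Weierstrass_m_test[of _ _ "\<lambda>n. (1 / 2) ^ n"])
      (use tree_poly_term_le assms in \<open>auto intro: summable_geometric\<close>)
  then have "uniform_limit {1..2} (\<lambda>n v. \<Sum>i<n. tree_poly i v * z ^ i) (tree_gf z) sequentially"
    by (simp add: tree_gf_def[abs_def])
  moreover have "continuous_on {1..2} (\<lambda>v. \<Sum>i<n. tree_poly i v * z ^ i)" for n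
    unfolding tree_poly_def by (intro continuous_intros)
  ultimately show ?thesis by (intro uniform_limit_theorem) auto
qed

text \<open>The quadratic method in discriminant form. The discriminant of the quadratic satisfied by
  \<open>tree_gf z v\<close> is a square along \<open>v\<close>, so a zero in the interior is a local minimum, hence a double zero.\<close>

lemma tree_gf_parametrization:
  assumes z: "0 < z" "z \<le> 1 / 128"
  shows "\<exists>t. 0 < t \<and> t < 1 \<and> z = t / (1 + t) ^ 3 \<and> tree_gf z 1 = (1 + t) ^ 3 * (1 - t)"
proof -
  define f where "f = tree_gf z 1"
  define K where "K v = v - 1 - z * v\<^sup>2" for v
  define b where "b v = K v - z\<^sup>2 * v * f" for v
  define c where "c v = v - 1 - z * v * f" for v
  define Q where "Q v = 2 * z * K v * tree_gf z v - b v" for v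
  define \<Delta> where "\<Delta> v = (b v)\<^sup>2 - 4 * z * K v * c v" for v
  have f: "1 \<le> f" "f \<le> 2" using tree_gf_ge_1[of 1 z] tree_gf_le_2[of 1 z] z by (auto simp: f_def)
  have quad: "z * K v * (tree_gf z v)\<^sup>2 - b v * tree_gf z v + c v = 0" if "1 \<le> v" "v \<le> 2" for v
    using tree_gf_functional[of v z] that z
    unfolding K_def b_def c_def f_def by (simp add: algebra_simps power2_eq_square)
  have Q2: "(Q v)\<^sup>2 = \<Delta> v" if "1 \<le> v" "v \<le> 2" for v
  proof -
    have "(Q v)\<^sup>2 - \<Delta> v = 4 * z * K v * (z * K v * (tree_gf z v)\<^sup>2 - b v * tree_gf z v + c v)"
      unfolding Q_def \<Delta>_def by algebra
    then show ?thesis using quad[OF that] by simp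
  qed
  have "z * f < 1" using mult_mono[of z "1 / 128" f 2] z f by simp
  then have Q1: "Q 1 > 0"
  proof -
    have "Q 1 = z * (1 - z * f)"
      unfolding Q_def b_def K_def f_def by (simp add: algebra_simps power2_eq_square)
    then show ?thesis using z \<open>z * f < 1\<close> by simp
  qed
  have Q2': "Q 2 < 0"
  proof -
    have "tree_gf z 2 \<le> 2" "0 \<le> tree_gf z 2" using tree_gf_le_2[of 2 z] tree_gf_ge_1[of 2 z] z by auto
    then have "z * (1 - 4 * z) * tree_gf z 2 \<le> z * 1 * 2"
      using z by (intro mult_mono) auto
    moreover have "z\<^sup>2 * f \<le> z * 2"
      using mult_mono[of "z * z" z f 2] z f mult_left_le[of z z] by (simp add: power2_eq_square)
    ultimately show ?thesis using z unfolding Q_def b_def K_def by (simp add: algebra_simps)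
  qed
  \<comment> \<open>\<open>Q\<close> changes sign strictly between 1 and 2, so a zero of the
    discriminant exists in the interior.\<close>
  have "continuous_on {1..2} Q"
    unfolding Q_def b_def K_def by (intro continuous_intros continuous_on_tree_gf) (use z in auto)
  then obtain V where V: "1 \<le> V" "V \<le> 2" "Q V = 0"
    using IVT2'[of Q 2 0 1] Q1 Q2' by auto
  then have V12: "1 < V" "V < 2" using Q1 Q2' by (auto simp: less_le)
  define \<phi> where "\<phi> = tree_gf z V"
  \<comment> \<open>At \<open>V\<close> the value \<phi> is a double root of the quadratic, which
    expresses both lower coefficients through the leading one.\<close>
  have b_eq: "b V = 2 * z * K V * \<phi>" using V unfolding Q_def \<phi>_def by simp
  have c_eq: "c V = z * K V * \<phi>\<^sup>2"
    using quad[of V] V b_eq unfolding \<phi>_def by (simp add: power2_eq_square)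
  have K0: "K V \<noteq> 0"
  proof
    assume "K V = 0"
    then have "z\<^sup>2 * V * f = 0" using b_eq unfolding b_def by simp
    then show False using z V f by simp
  qed
  define K' where "K' = 1 - 2 * z * V"
  have dK: "(K has_real_derivative K') (at V)"
    unfolding K_def K'_def by (auto intro!: derivative_eq_intros)
  \<comment> \<open>Only the polynomial \<Delta> is differentiated; of \<open>tree_gf\<close> itself
    continuity in \<open>v\<close> is enough.\<close>
  have d\<Delta>: "(\<Delta> has_real_derivative
      2 * b V * (K' - z\<^sup>2 * f) - (4 * z * K' * c V + 4 * z * K V * (1 - z * f))) (at V)"
    unfolding \<Delta>_def b_def c_def
    by (auto intro!: derivative_eq_intros dK simp: algebra_simps power2_eq_square)
  have "\<forall>y. \<bar>V - y\<bar> < min (V - 1) (2 - V) \<longrightarrow> \<Delta> V \<le> \<Delta> y"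
  proof (intro allI impI)
    fix y assume "\<bar>V - y\<bar> < min (V - 1) (2 - V)"
    then have y: "1 \<le> y" "y \<le> 2" by (auto simp: abs_less_iff)
    show "\<Delta> V \<le> \<Delta> y" using Q2[OF V(1,2)] Q2[OF y] V(3) zero_le_power2[of "Q y"] by simp
  qed
  from DERIV_local_min[OF d\<Delta> _ this]
  have "2 * b V * (K' - z\<^sup>2 * f) - (4 * z * K' * c V + 4 * z * K V * (1 - z * f)) = 0"
    using V12 by simp
  then have "4 * z * K V * (\<phi> * (K' - z\<^sup>2 * f) - z * K' * \<phi>\<^sup>2 - (1 - z * f)) = 0"
    unfolding b_eq c_eq by algebra
  then have dv: "\<phi> * (K' - z\<^sup>2 * f) - z * K' * \<phi>\<^sup>2 - (1 - z * f) = 0"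
    using K0 z by simp
  define B where "B = 1 - z * \<phi>"
  define t where "t = V - 1"
  have t: "0 < t" "t < 1" and Vt: "V = 1 + t" using V12 by (auto simp: t_def)
  have e1: "z\<^sup>2 * V * f = K V * (2 * B - 1)"
    using b_eq unfolding b_def B_def by algebra
  have e2: "K V * B\<^sup>2 = z * t"
  proof -
    have "z * V * f = t - z * K V * \<phi>\<^sup>2" using c_eq unfolding c_def t_def by simp
    then have "z * (z * V * f) = z * (t - z * K V * \<phi>\<^sup>2)" by simp
    then show ?thesis using e1 unfolding B_def by algebra
  qed
  have KV: "K V = t - z * V\<^sup>2" unfolding K_def t_def by simp
  have B0: "B \<noteq> 0" using e2 z t by auto
  have e3: "B * (1 - z * V\<^sup>2 + (V - 2) * B) = z * V"
  proof -
    have "B * (K' * \<phi> + z * f) = 1" using dv unfolding B_def by algebra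
    then have "B * (K' * (z * \<phi>) * V + z\<^sup>2 * V * f) = z * V" by algebra
    then have "B * (K' * (1 - B) * V + K V * (2 * B - 1)) = z * V"
      unfolding e1 by (simp add: B_def)
    then show ?thesis unfolding K'_def KV t_def by algebra
  qed
  have D: "z * (t + V\<^sup>2 * B\<^sup>2) = t * B\<^sup>2" using e2 unfolding KV by algebra
  \<comment> \<open>The parametrization amounts to \<open>x = 1\<close>. Eliminating
    \<open>f\<close> and \<open>z\<close> from the three equations at \<open>V\<close> leaves a
    product with the factor \<open>1 - x\<close> and a quadratic in \<open>x\<close> that is
    positive for \<open>t\<close> between 0 and 1.\<close>
  define x where "x = V * B"
  have "B * ((1 - x) * ((1 - t) * x\<^sup>2 - t * (1 - t) * x + t * (1 + t))) = 0"
  proof -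
    have "(t + V\<^sup>2 * B\<^sup>2) * (B * (1 - z * V\<^sup>2 + (V - 2) * B)) = (t + V\<^sup>2 * B\<^sup>2) * (z * V)"
      using e3 by simp
    then have "B * ((t + V\<^sup>2 * B\<^sup>2) * (1 + (V - 2) * B) - t * B\<^sup>2 * V\<^sup>2) = t * B\<^sup>2 * V"
      using D by algebra
    then show ?thesis unfolding x_def Vt by algebra
  qed
  moreover have "(1 - t) * x\<^sup>2 - t * (1 - t) * x + t * (1 + t) > 0"
  proof -
    have "(1 - t) * x\<^sup>2 - t * (1 - t) * x + t * (1 + t)
        = (1 - t) * (x - t / 2)\<^sup>2 + t * (1 - t * (1 - t) / 4) + t\<^sup>2"
      by (simp add: power2_eq_square algebra_simps)
    moreover have "t * (1 - t) \<le> 1 * 1" using t by (intro mult_mono) auto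
    ultimately show ?thesis using t by (simp add: add_nonneg_pos add_pos_nonneg)
  qed
  ultimately have x1: "V * B = 1" using B0 unfolding x_def by auto
  have zt: "z * V ^ 3 = t"
  proof -
    have "V\<^sup>2 * (z * (t + V\<^sup>2 * B\<^sup>2)) = V\<^sup>2 * (t * B\<^sup>2)" using D by simp
    then have "z * V\<^sup>2 * (t + (V * B)\<^sup>2) = t * (V * B)\<^sup>2" by algebra
    then have "z * V\<^sup>2 * (t + 1) = t" unfolding x1 by simp
    moreover have "t + 1 = V" using Vt by simp
    ultimately show ?thesis by (simp add: power3_eq_cube power2_eq_square)
  qed
  have "f * z = t * (1 - t)"
  proof -
    have "V\<^sup>2 * (K V * B\<^sup>2) = V\<^sup>2 * (z * t)" using e2 by simp
    then have KV2: "K V = V\<^sup>2 * z * t" using x1 by algebra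
    have "z * V * (f * z) = z * V * (t * (2 * (V * B) - V))" using e1 unfolding KV2 by algebra
    then have "f * z = t * (2 * (V * B) - V)" using z V by simp
    then have "f * z = t * (2 * 1 - V)" unfolding x1 .
    then show ?thesis using Vt by simp
  qed
  then have "f * (z * V ^ 3) = t * (1 - t) * V ^ 3" by algebra
  then have "f = V ^ 3 * (1 - t)" unfolding zt using t by simp
  moreover have "z = t / V ^ 3" using zt V by (simp add: field_simps)
  ultimately show ?thesis using t unfolding f_def Vt by blast
qed

text \<open>If the radius of convergence exceeded \<open>4/27\<close>, the maximum of \<open>t / (1 + t)\<^sup>3\<close> for \<open>t \<ge> 0\<close>, the identity
  \<open>tree_gf (t / (1 + t)\<^sup>3) 1 = (1 + t)\<^sup>3 (1 - t)\<close> would continue from small \<open>t\<close> to \<open>t = 1\<close>, where the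
  right-hand side vanishes.\<close>

lemma dtrees_radius:
  assumes R: "R > 4 / 27" and sum: "summable (\<lambda>n. real (card (dtrees n)) * R ^ n)"
  shows False
proof -
  define \<phi> :: "complex \<Rightarrow> complex" where "\<phi> w = (\<Sum>n. of_nat (card (dtrees n)) * w ^ n)" for w
  have sm: "(\<lambda>n. of_nat (card (dtrees n)) * w ^ n) sums \<phi> w" if "w \<in> ball 0 R" for w
  proof -
    have "summable (\<lambda>n. complex_of_nat (card (dtrees n)) * (complex_of_real R) ^ n)"
      using summable_of_real[OF sum, where 'a = complex] by simp
    from powser_inside[OF this, of w] show ?thesis
      unfolding \<phi>_def using that R by (intro summable_sums) simp
  qed
  then have hol: "\<phi> holomorphic_on ball 0 R"
    by (intro power_series_holomorphic[where a = "\<lambda>n. of_nat (card (dtrees n))"]) simp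
  have real: "\<phi> (of_real z) = of_real (\<Sum>n. real (card (dtrees n)) * z ^ n)"
    "summable (\<lambda>n. real (card (dtrees n)) * z ^ n)" if "\<bar>z\<bar> < R" for z
  proof -
    show s: "summable (\<lambda>n. real (card (dtrees n)) * z ^ n)"
      using powser_inside[OF sum, of z] that R by simp
    show "\<phi> (of_real z) = of_real (\<Sum>n. real (card (dtrees n)) * z ^ n)"
      unfolding \<phi>_def by (subst suminf_of_real[OF s]) simp
  qed
  define h :: "complex \<Rightarrow> complex" where "h t = t / (1 + t) ^ 3" for t
  define W where "W = {t \<in> - {-1}. h t \<in> ball 0 R}"
  have holh: "h holomorphic_on - {-1}"
    unfolding h_def by (intro holomorphic_intros) (auto simp: add_eq_0_iff)
  have oW: "open W"
    unfolding W_def using continuous_open_preimage[OF holomorphic_on_imp_continuous_on[OF holh], of "ball 0 R"]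
    by (auto simp: vimage_def Int_def)
  \<comment> \<open>Analytic continuation needs a connected open set; this component contains the
    whole segment from 0 to 1.\<close>
  define U where "U = connected_component_set W 0"
  have U: "open U" "connected U" "U \<subseteq> W"
    using oW unfolding U_def by (auto intro: open_connected_component connected_component_subset[THEN subsetD])
  have inW: "of_real t \<in> W" if "0 \<le> t" "t \<le> 1" for t :: real
  proof -
    \<comment> \<open>This product equals \<open>4 * (1 + t) ^ 3 - 27 * t\<close>; its double zero
      is the maximum point 1/2 of \<open>t / (1 + t) ^ 3\<close>.\<close>
    have "0 \<le> (2 * t - 1)\<^sup>2 * (t + 4)" using that by simp
    then have "27 * t \<le> 4 * (1 + t) ^ 3"
      by (simp add: power2_eq_square power3_eq_cube algebra_simps)
    then have "t / (1 + t) ^ 3 \<le> 4 / 27" using that by (simp add: field_simps)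
    moreover have "norm (h (of_real t)) = t / (1 + t) ^ 3"
    proof -
      have "h (of_real t) = of_real (t / (1 + t) ^ 3)" by (simp add: h_def)
      then show ?thesis using that by (simp only: norm_of_real) simp
    qed
    moreover have "complex_of_real t \<noteq> -1"
      using that by (metis of_real_1 of_real_eq_iff of_real_minus neg_0_le_iff_le not_one_le_zero)
    moreover have "norm (h (of_real t)) < R" using calculation(1,2) R by linarith
    ultimately show ?thesis by (simp add: W_def)
  qed
  have inU: "of_real t \<in> U" if "0 \<le> t" "t \<le> 1" for t :: real
  proof -
    have "of_real ` {0..1::real} \<subseteq> U"
      unfolding U_def
    proof (rule connected_component_maximal)
      show "(0::complex) \<in> of_real ` {0..1::real}" by force
      show "connected (complex_of_real ` {0..1::real})"
        by (intro connected_continuous_image continuous_intros) simp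
    qed (use inW in auto)
    then show ?thesis using that by auto
  qed
  define \<psi> where "\<psi> t = \<phi> (h t) - (1 + t) ^ 3 * (1 - t)" for t
  have hol\<psi>: "\<psi> holomorphic_on U"
  proof -
    have "(\<phi> \<circ> h) holomorphic_on U"
      by (rule holomorphic_on_compose_gen[OF holomorphic_on_subset[OF holh] hol])
        (use U(3) in \<open>auto simp: W_def\<close>)
    then show ?thesis unfolding \<psi>_def by (intro holomorphic_intros) (simp add: o_def)
  qed
  define T where "T = {w \<in> U. \<psi> w = 0}"
  have lim: "0 islimpt T"
    unfolding islimpt_approachable
  proof (intro allI impI)
    fix e :: real assume "e > 0"
    \<comment> \<open>The first bound is the range of the parametrization; the second gives
      \<open>t \<le> e / 2\<close>, because \<open>t \<le> 8 * z\<close>.\<close>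
    define z where "z = min (1 / 128) (e / 16)"
    have z: "0 < z" "z \<le> 1 / 128" "z \<le> e / 16" using \<open>e > 0\<close> by (auto simp: z_def)
    obtain t where t: "0 < t" "t < 1" "z = t / (1 + t) ^ 3" "tree_gf z 1 = (1 + t) ^ 3 * (1 - t)"
      using tree_gf_parametrization[OF z(1,2)] by blast
    have "(1 + t) ^ 3 \<le> 2 ^ 3" using t by (intro power_mono) auto
    then have "z * (1 + t) ^ 3 \<le> z * 8" using z by (intro mult_left_mono) auto
    moreover have "z * (1 + t) ^ 3 = t" using t by simp
    ultimately have "t \<le> 8 * z" by linarith
    then have "t < e" using z \<open>e > 0\<close> by linarith
    have "h (of_real t) = of_real z" unfolding h_def t(3) by simp
    moreover have "\<phi> (of_real z) = of_real (tree_gf z 1)"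
      using real(1)[of z] z R by (simp add: tree_gf_def tree_poly_1)
    ultimately have "\<psi> (of_real t) = 0" unfolding \<psi>_def t(4) by simp
    then have "of_real t \<in> T" using inU[of t] t by (simp add: T_def)
    then show "\<exists>x'\<in>T. x' \<noteq> 0 \<and> dist x' 0 < e"
      using t \<open>t < e\<close> by (intro bexI[of _ "of_real t"]) auto
  qed
  have "\<psi> 1 = 0"
    by (rule analytic_continuation[OF hol\<psi> U(1,2) _ _ lim])
      (use inU[of 0] inU[of 1] in \<open>auto simp: T_def\<close>)
  \<comment> \<open>Here \<open>h 1 = 1/8\<close>, where a series with nonnegative coefficients and
    constant term 1 cannot vanish.\<close>
  then have "\<phi> (of_real (1 / 8)) = 0" by (simp add: \<psi>_def h_def)
  moreover have "(\<Sum>n. real (card (dtrees n)) * (1 / 8) ^ n) \<ge> 1"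
  proof -
    have "sum (\<lambda>n. real (card (dtrees n)) * (1 / 8) ^ n) {..<1} \<le> (\<Sum>n. real (card (dtrees n)) * (1 / 8) ^ n)"
      by (rule sum_le_suminf[OF real(2)]) (use R in auto)
    then show ?thesis by (simp add: dtrees_0)
  qed
  moreover have "\<phi> (of_real (1 / 8)) = of_real (\<Sum>n. real (card (dtrees n)) * (1 / 8) ^ n)"
    by (rule real(1)) (use R in simp)
  ultimately show False by (simp only: of_real_eq_0_iff)
qed

section \<open>The growth rate\<close>

lemma choose_sums:
  fixes w :: real
  assumes "0 \<le> w" "w < 1"
  shows "(\<lambda>k. real (p + k choose k) * w ^ k) sums (1 / (1 - w) ^ Suc p)"
proof (induction p)
  case 0
  show ?case using geometric_sums[of w] assms by simp
next
  case (Suc p)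
  let ?a = "\<lambda>k. real (p + k choose k) * w ^ k"
  have "(\<lambda>k. \<Sum>i\<le>k. ?a i * w ^ (k - i)) sums ((\<Sum>k. ?a k) * (\<Sum>k. w ^ k))"
    by (rule Cauchy_product_sums)
      (use Suc assms in \<open>auto simp: sums_iff intro: summable_geometric\<close>)
  also have "(\<lambda>k. \<Sum>i\<le>k. ?a i * w ^ (k - i)) = (\<lambda>k. real (Suc p + k choose k) * w ^ k)"
  proof
    fix k
    have "(\<Sum>i\<le>k. ?a i * w ^ (k - i)) = (\<Sum>i\<le>k. real (p + i choose i)) * w ^ k"
      unfolding sum_distrib_right by (rule sum.cong) (auto simp: mult.assoc simp flip: power_add)
    also have "(\<Sum>i\<le>k. real (p + i choose i)) = real (Suc p + k choose k)"
      using sum_choose_lower[of p k] by (simp flip: of_nat_sum)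
    finally show "(\<Sum>i\<le>k. ?a i * w ^ (k - i)) = real (Suc p + k choose k) * w ^ k" .
  qed
  also have "(\<Sum>k. ?a k) * (\<Sum>k. w ^ k) = 1 / (1 - w) ^ Suc (Suc p)"
    using Suc suminf_geometric[of w] assms by (simp add: sums_iff)
  finally show ?case .
qed

text \<open>Bounds for all \<open>k\<close> are added up with the weights \<open>w ^ k\<close>: the
  left side becomes a negative binomial series, the right side a geometric one.\<close>

lemma choose_bound:
  fixes x y w \<rho> :: real
  assumes w: "0 \<le> w" "w < 1" and \<rho>: "0 \<le> \<rho>" "\<rho> < 1"
    and le: "\<And>k. x * (real (p + k choose k) * w ^ k) \<le> y * \<rho> ^ k"
  shows "x \<le> y * (1 - w) ^ Suc p / (1 - \<rho>)"
proof -
  have "x * (1 / (1 - w) ^ Suc p) \<le> y * (1 / (1 - \<rho>))"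
    using sums_le[OF le sums_mult[OF choose_sums[OF w]] sums_mult[OF geometric_sums]] \<rho> by simp
  then show ?thesis using w by (simp add: field_simps)
qed

text \<open>The number \<open>0.319\<close> is just below \<open>1 / sqrt 9.81\<close>, so the bounds for all run lengths can be summed,
  and \<open>6.68061 = 9.81 * (1 - 0.319)\<close> is below the growth rate \<open>27/4\<close> of the trees.\<close>

lemma card_dominoes_bound:
  assumes g: "growth_rate [1, 3, 2, 4] \<le> 9.81" and q: "q \<le> n"
  defines "\<rho> \<equiv> 0.319 * sqrt 9.81"
  shows "real (card (dominoes n q)) \<le> (6.68061 :: real) ^ n / (1 - \<rho>)\<^sup>2"
proof -
  let ?s = "sqrt 9.81 :: real"
  have "?s < 1 / 0.319" by (rule real_less_lsqrt) (auto simp: power2_eq_square)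
  then have \<rho>: "0 \<le> \<rho>" "\<rho> < 1" by (auto simp: \<rho>_def)
  define d where "d = real (card (dominoes n q))"
  have prod: "d * real (n - q + k choose k) * real (q + k' choose k') \<le> 9.81 ^ n * ?s ^ k * ?s ^ k'"
    for k k'
  proof (rule power2_le_imp_le)
    have "(d * real (n - q + k choose k) * real (q + k' choose k'))\<^sup>2 \<le> (real (card (dec_ends k' k (n + k + k'))))\<^sup>2"
      using card_domino_dec_ends[OF q, of k k'] unfolding d_def
      by (intro power_mono) (simp_all flip: of_nat_mult)
    also have "\<dots> \<le> growth_rate [1, 3, 2, 4] ^ (2 * (n + k + k') - k' - k)"
      by (rule card_dec_ends_bound) simp
    also have "\<dots> \<le> 9.81 ^ (2 * (n + k + k') - k' - k)"
      by (rule power_mono[OF g]) (use growth_rate_ge_1 in simp)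
    also have "2 * (n + k + k') - k' - k = 2 * n + k + k'" by simp
    also have "(9.81 :: real) ^ (2 * n + k + k') = (9.81 ^ n * ?s ^ k * ?s ^ k')\<^sup>2"
    proof -
      have "(?s ^ m)\<^sup>2 = 9.81 ^ m" for m
        by (simp flip: power_mult add: mult.commute[of m] power_mult)
      then show ?thesis by (simp add: power_add power_mult power_mult_distrib mult.commute flip: power_mult)
    qed
    finally show "(d * real (n - q + k choose k) * real (q + k' choose k'))\<^sup>2 \<le> (9.81 ^ n * ?s ^ k * ?s ^ k')\<^sup>2" .
  qed simp
  \<comment> \<open>The two run lengths are independent, so one is summed out with the other held
    fixed.\<close>
  have 1: "d * real (q + k' choose k') \<le> 9.81 ^ n * ?s ^ k' * (1 - 0.319) ^ Suc (n - q) / (1 - \<rho>)" for k'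
  proof (rule choose_bound[OF _ _ \<rho>])
    fix k
    have "d * real (q + k' choose k') * (real (n - q + k choose k) * 0.319 ^ k)
        = (d * real (n - q + k choose k) * real (q + k' choose k')) * 0.319 ^ k" by simp
    also have "\<dots> \<le> (9.81 ^ n * ?s ^ k * ?s ^ k') * 0.319 ^ k"
      by (rule mult_right_mono[OF prod]) simp
    also have "\<dots> = 9.81 ^ n * ?s ^ k' * \<rho> ^ k"
      unfolding \<rho>_def power_mult_distrib by (simp only: mult_ac)
    finally show "d * real (q + k' choose k') * (real (n - q + k choose k) * 0.319 ^ k)
      \<le> 9.81 ^ n * ?s ^ k' * \<rho> ^ k" .
  qed auto
  have "d \<le> (9.81 ^ n * (1 - 0.319) ^ Suc (n - q) / (1 - \<rho>)) * (1 - 0.319) ^ Suc q / (1 - \<rho>)"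
  proof (rule choose_bound[OF _ _ \<rho>])
    fix k
    have "d * (real (q + k choose k) * 0.319 ^ k) = d * real (q + k choose k) * 0.319 ^ k" by simp
    also have "\<dots> \<le> (9.81 ^ n * ?s ^ k * (1 - 0.319) ^ Suc (n - q) / (1 - \<rho>)) * 0.319 ^ k"
      by (rule mult_right_mono[OF 1]) simp
    also have "\<dots> = (9.81 ^ n * (1 - 0.319) ^ Suc (n - q) / (1 - \<rho>)) * \<rho> ^ k"
      unfolding \<rho>_def power_mult_distrib by (simp add: mult_ac)
    finally show "d * (real (q + k choose k) * 0.319 ^ k)
      \<le> (9.81 ^ n * (1 - 0.319) ^ Suc (n - q) / (1 - \<rho>)) * \<rho> ^ k" .
  qed auto
  also have "\<dots> = (9.81 ^ n * ((1 - 0.319) ^ (n - q) * (1 - 0.319) ^ q)) * 0.681\<^sup>2 / (1 - \<rho>)\<^sup>2"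
  proof -
    have "(A * (1 - 0.319) ^ Suc a / r) * (1 - 0.319) ^ Suc b / r
        = (A * ((1 - 0.319) ^ a * (1 - 0.319) ^ b)) * 0.681\<^sup>2 / r\<^sup>2" for A r :: real and a b
      by (simp add: power2_eq_square)
    then show ?thesis .
  qed
  also have "(1 - 0.319 :: real) ^ (n - q) * (1 - 0.319) ^ q = 0.681 ^ n"
    using q by (simp flip: power_add)
  also have "(9.81 :: real) ^ n * 0.681 ^ n = 6.68061 ^ n" by (simp flip: power_mult_distrib)
  also have "(6.68061 :: real) ^ n * 0.681\<^sup>2 / (1 - \<rho>)\<^sup>2 \<le> 6.68061 ^ n / (1 - \<rho>)\<^sup>2"
    by (intro divide_right_mono) (simp_all add: power2_eq_square)
  finally show ?thesis unfolding d_def .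
qed

theorem theorem1:
  shows "growth_rate [1, 3, 2, 4] > 9.81"
proof (rule ccontr)
  assume "\<not> growth_rate [1, 3, 2, 4] > 9.81"
  then have g: "growth_rate [1, 3, 2, 4] \<le> 9.81" by simp
  define M :: real where "M = 1 / (1 - 0.319 * sqrt 9.81)\<^sup>2"
  have card: "real (card (dtrees n)) \<le> M * (real (Suc n) * 6.68061 ^ n)" for n
  proof -
    have "real (card (dtrees n)) \<le> real (\<Sum>q\<le>n. card (dominoes n q))"
      using card_dtrees[of n] by (simp only: of_nat_le_iff)
    also have "\<dots> = (\<Sum>q\<le>n. real (card (dominoes n q)))" by simp
    also have "\<dots> \<le> (\<Sum>q\<le>n. M * 6.68061 ^ n)"
      by (rule sum_mono) (use card_dominoes_bound[OF g] in \<open>simp add: M_def\<close>)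
    also have "\<dots> = M * (real (Suc n) * 6.68061 ^ n)" by simp
    finally show ?thesis .
  qed
  \<comment> \<open>The point 0.149 lies just above 4/27 = 0.1481..., while 6.68061 times 0.149 is
    about 0.995 and still below 1.\<close>
  have "summable (\<lambda>n. real (card (dtrees n)) * 0.149 ^ n)"
  proof (rule summable_comparison_test'[of "\<lambda>n. M * (real (Suc n) * (6.68061 * 0.149) ^ n)" 0])
    show "summable (\<lambda>n. M * (real (Suc n) * (6.68061 * 0.149) ^ n))"
      by (intro summable_mult sums_summable[OF geometric_deriv_sums]) simp
    fix n
    have "real (card (dtrees n)) * 0.149 ^ n \<le> M * (real (Suc n) * 6.68061 ^ n) * 0.149 ^ n"
      by (rule mult_right_mono[OF card]) simp
    also have "\<dots> = M * (real (Suc n) * (6.68061 * 0.149) ^ n)"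
      unfolding power_mult_distrib by (simp only: mult_ac)
    finally show "norm (real (card (dtrees n)) * 0.149 ^ n) \<le> M * (real (Suc n) * (6.68061 * 0.149) ^ n)"
      by simp
  qed
  then show False using dtrees_radius[of "0.149"] by simp
qed

end
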